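(* Let $n\ge 2$ and let $(G,f)$ be an $n$-ary group. Then for any $a\in G$ there is a one-one correspondence between the set of all irreducible representations of $(G,f)$ and the set of all irreducible representations of the group $G^{\ast}_a$ (Post's cover of $(G,f)$). This correspondence is the map $\Lambda\mapsto\Lambda^{\ast}$, where $$\Lambda^{\ast}(x,i)=\Lambda(x)\Lambda(a)^i\qquad (x\in G,\ 0\le i\le n-2).$$ Especially, if $G$ is finite, then the number of irreducible representations of $(G,f)$, up to equivalence, is finite.
   Context: Notation: $x_i^j$ denotes the sequence $x_i,x_{i+1},\ldots,x_j$ (empty if $j<i$), and $\stackrel{(t)}{x}$ denotes $x$ repeated $t$ times (empty if $t=0$). An $n$-ary group $(G,f)$ ($n\ge 2$), also called a polyadic group, is a non-empty set $G$ with an operation $f:G^n\to G$ that is associative, i.e. $f(x_1^{i-1},f(x_i^{n+i-1}),x_{n+i}^{2n-1})=f(x_1^{j-1},f(x_j^{n+j-1}),x_{n+j}^{2n-1})$ for all $1\le i,j\le n$ and $x_1,\ldots,x_{2n-1}\in G$, and such that for all $x_0,x_1,\ldots,x_n\in G$ and each $i\in\{1,\ldots,n\}$ there is a unique $z\in G$ with $f(x_1^{i-1},z,x_{i+1}^n)=x_0$. For $x\in G$ the skew element $\overline{x}$ is the unique $z\in G$ with $f(\stackrel{(n-1)}{x},z)=x$. Post's cover: for fixed $a\in G$, $G^{\ast}_a=\{(x,i): x\in G,\ i\in\mathbb{Z}_{n-1}\}$, where elements of $\mathbb{Z}_{n-1}$ are represented by integers $0\le i\le n-2$, with the binary operation $$(x,i)\cdot(y,j)=(f_{\ast}(x,\stackrel{(i)}{a},y,\stackrel{(j)}{a},\overline{a},\stackrel{(n-2-i\ast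 j)}{a}),\ i\ast j),$$ where $i\ast j\in\{0,\ldots,n-2\}$, $i\ast j\equiv i+j+1 \pmod{n-1}$, and $f_{\ast}$ means that $f$ is applied once or twice according to the number of arguments ($n$ or $2n-1$). It is known that $G^{\ast}_a$ is a group with identity $(\overline{a},n-2)$. A representation of $(G,f)$ of degree $m\geq 1$ is a map $\Lambda:G\to GL_m(\mathbb{C})$ with $\Lambda(f(x_1^n))=\Lambda(x_1)\Lambda(x_2)\cdots\Lambda(x_n)$ for all $x_1,\ldots,x_n\in G$. It is irreducible if no subspace of $\mathbb{C}^m$ other than $0$ and $\mathbb{C}^m$ is invariant under all $\Lambda(x)$, $x\in G$. Two representations $\Lambda,\Lambda'$ of degree $m$ are equivalent if there is $T\in GL_m(\mathbb{C})$ with $\Lambda'(x)=T\Lambda(x)T^{-1}$ for all $x\in G$. Representations of the group $G^{\ast}_a$ are ordinary group homomorphisms $G^{\ast}_a\to GL_m(\mathbb{C})$. *)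

theory Defs
  imports Jordan_Normal_Form.VS_Connect
begin

text \<open>An \<open>n\<close>-ary operation is a function on lists, only ever used on lists of length \<open>n\<close>
  (sequences \<open>x\<^sub>1, \<dots>, x\<^sub>n\<close>) with entries in the carrier; list positions count from \<open>0\<close>.\<close>

locale nary_group =
  fixes n :: nat and G :: "'a set" and f :: "'a list \<Rightarrow> 'a"
  assumes arity: "n \<ge> 2"
    and nonempty: "G \<noteq> {}"
    and closed: "\<lbrakk>length xs = n; set xs \<subseteq> G\<rbrakk> \<Longrightarrow> f xs \<in> G"
    and assoc: "\<lbrakk>length xs = 2 * n - 1; set xs \<subseteq> G; i < n; j < n\<rbrakk> \<Longrightarrow>
      f (take i xs @ [f (take n (drop i xs))] @ drop (i + n) xs) =
      f (take j xs @ [f (take n (drop j xs))] @ drop (j + n) xs)"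
    and solvable: "\<lbrakk>x\<^sub>0 \<in> G; length xs = n; set xs \<subseteq> G; i < n\<rbrakk> \<Longrightarrow>
      \<exists>!z. z \<in> G \<and> f (take i xs @ [z] @ drop (Suc i) xs) = x\<^sub>0"

definition skew :: "nat \<Rightarrow> 'a set \<Rightarrow> ('a list \<Rightarrow> 'a) \<Rightarrow> 'a \<Rightarrow> 'a" where
  "skew n G f x = (THE z. z \<in> G \<and> f (replicate (n - 1) x @ [z]) = x)"

text \<open>\<open>f\<^sub>*\<close>: one application of \<open>f\<close> to \<open>n\<close> arguments, two applications to \<open>2n - 1\<close> arguments.\<close>

definition f_star :: "nat \<Rightarrow> ('a list \<Rightarrow> 'a) \<Rightarrow> 'a list \<Rightarrow> 'a" where
  "f_star n f xs = (if length xs = n then f xs else f (f (take n xs) # drop n xs))"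

definition Post_cover :: "nat \<Rightarrow> 'a set \<Rightarrow> ('a list \<Rightarrow> 'a) \<Rightarrow> 'a \<Rightarrow> ('a \<times> nat) monoid" where
  "Post_cover n G f a =
    \<lparr>carrier = G \<times> {0..n - 2},
     mult = (\<lambda>(x, i) (y, j). let k = (i + j + 1) mod (n - 1) in
       (f_star n f ([x] @ replicate i a @ [y] @ replicate j a @ [skew n G f a]
          @ replicate (n - 2 - k) a), k)),
     one = (skew n G f a, n - 2)\<rparr>"

abbreviation GL :: "nat \<Rightarrow> complex mat monoid" where
  "GL m \<equiv> units_of (ring_mat TYPE(complex) m ())"

text \<open>Representations are extensional functions (\<open>undefined\<close> outside the carrier), so that equality
  of functions is equality of representations.\<close>

definition nary_rep ::
  "nat \<Rightarrow> 'a set \<Rightarrow> ('a list \<Rightarrow> 'a) \<Rightarrow> nat \<Rightarrow> ('a \<Rightarrow> complex mat) \<Rightarrow> bool" where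
  "nary_rep n G f m \<Lambda> \<longleftrightarrow> m \<ge> 1 \<and> \<Lambda> \<in> G \<rightarrow>\<^sub>E carrier (GL m) \<and>
    (\<forall>xs. length xs = n \<and> set xs \<subseteq> G \<longrightarrow> \<Lambda> (f xs) = foldr (*) (map \<Lambda> xs) (1\<^sub>m m))"

definition group_rep :: "'b monoid \<Rightarrow> nat \<Rightarrow> ('b \<Rightarrow> complex mat) \<Rightarrow> bool" where
  "group_rep H m \<Phi> \<longleftrightarrow> m \<ge> 1 \<and> \<Phi> \<in> hom H (GL m) \<and> \<Phi> \<in> extensional (carrier H)"

definition irreducible_on :: "'b set \<Rightarrow> nat \<Rightarrow> ('b \<Rightarrow> complex mat) \<Rightarrow> bool" where
  "irreducible_on X m \<Phi> \<longleftrightarrow>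
    (\<forall>W. subspace class_ring W (module_vec TYPE(complex) m) \<and>
         (\<forall>x\<in>X. \<forall>w\<in>W. \<Phi> x *\<^sub>v w \<in> W)
       \<longrightarrow> W = {0\<^sub>v m} \<or> W = carrier_vec m)"

definition irr_nary_reps :: "nat \<Rightarrow> 'a set \<Rightarrow> ('a list \<Rightarrow> 'a) \<Rightarrow> ('a \<Rightarrow> complex mat) set" where
  "irr_nary_reps n G f = {\<Lambda>. \<exists>m. nary_rep n G f m \<Lambda> \<and> irreducible_on G m \<Lambda>}"

definition irr_group_reps :: "'b monoid \<Rightarrow> ('b \<Rightarrow> complex mat) set" where
  "irr_group_reps H = {\<Phi>. \<exists>m. group_rep H m \<Phi> \<and> irreducible_on (carrier H) m \<Phi>}"

definition nary_rep_equiv ::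
  "nat \<Rightarrow> 'a set \<Rightarrow> ('a list \<Rightarrow> 'a) \<Rightarrow> (('a \<Rightarrow> complex mat) \<times> ('a \<Rightarrow> complex mat)) set" where
  "nary_rep_equiv n G f =
    {(\<Lambda>, \<Lambda>'). \<exists>m. nary_rep n G f m \<Lambda> \<and> nary_rep n G f m \<Lambda>' \<and>
       (\<exists>T\<in>carrier (GL m). \<forall>x\<in>G. \<Lambda>' x = T * \<Lambda> x * inv\<^bsub>GL m\<^esub> T)}"

end

theory Submission
  imports Defs
begin

text \<open>Doernte's identities for the skew element (\<open>f(y, a, \<dots>, a, z, a, \<dots>, a) = y\<close> for \<open>z\<close> the skew
  element of \<open>a\<close> at any position after \<open>y\<close>) make \<open>\<Lambda>\<^sup>*\<close> multiplicative, and they give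
  \<open>(x, i) = (x, 0) \<cdot> (a, 0)\<^sup>i\<close> and \<open>(x\<^sub>1, 0) \<cdots> (x\<^sub>n, 0) = (f(x\<^sub>1, \<dots>, x\<^sub>n), 0)\<close> in Post's cover, so that
  restriction to \<open>G \<times> {0}\<close> inverts the correspondence. For finite \<open>G\<close>, averaging a matrix unit over the
  cover produces an intertwiner, so by Schur's lemma matrix coefficients of pairwise inequivalent
  irreducible representations are biorthogonal functions on the cover; hence there are at most
  \<open>(n - 1) \<cdot> card G\<close> classes. This only needs that left multiplication by \<open>(x, 0)\<close> permutes
  the cover, not that the cover is a group.\<close>

section \<open>Skew elements and Post's cover\<close>

context nary_group
begin

text \<open>Counterpart of the locale axiom \<open>assoc\<close> without positions: each later use
  only has to exhibit two decompositions of the same word.\<close>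

lemma assoc_append:
  assumes "us @ ys @ vs = us' @ ys' @ vs'" "length ys = n" "length ys' = n"
    and "length us + length vs = n - 1" "set (us @ ys @ vs) \<subseteq> G"
  shows "f (us @ f ys # vs) = f (us' @ f ys' # vs')"
proof -
  let ?xs = "us @ ys @ vs"
  have len: "length ?xs = 2 * n - 1" using assms(2,4) arity by simp
  have "length ?xs = length (us' @ ys' @ vs')" using assms(1) by simp
  then have "length us < n" "length us' < n"
    using assms(2-4) arity by simp_all
  from assoc[OF len assms(5) this]
  have "f (take (length us) ?xs @ [f (take n (drop (length us) ?xs))] @ drop (length us + n) ?xs) =
    f (take (length us') (us' @ ys' @ vs') @ [f (take n (drop (length us') (us' @ ys' @ vs')))]
      @ drop (length us' + n) (us' @ ys' @ vs'))"
    unfolding assms(1) .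
  then show ?thesis using assms(2,3) by simp
qed

text \<open>The uniqueness half of \<open>solvable\<close>; \<open>solution\<close> is the existence
  half.\<close>

lemma cancel:
  assumes "f (us @ y # vs) = f (us @ z # vs)" "y \<in> G" "z \<in> G" "set us \<subseteq> G" "set vs \<subseteq> G"
    and "length us + length vs = n - 1"
  shows "y = z"
proof -
  have "length us < n" "length (us @ y # vs) = n" "set (us @ y # vs) \<subseteq> G"
    using assms arity by auto
  from solvable[OF closed[OF this(2,3)] this(2,3,1)]
  have "\<exists>!w. w \<in> G \<and> f (us @ w # vs) = f (us @ y # vs)" by simp
  then show ?thesis using assms(1-3) by auto
qed

lemma solution:
  assumes "x \<in> G" "set us \<subseteq> G" "set vs \<subseteq> G" "length us + length vs = n - 1"
  obtains z where "z \<in> G" "f (us @ z # vs) = x"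
proof -
  have "length us < n" "length (us @ x # vs) = n" "set (us @ x # vs) \<subseteq> G"
    using assms arity by auto
  from solvable[OF assms(1) this(2,3,1)]
  have "\<exists>!w. w \<in> G \<and> f (us @ w # vs) = x" by simp
  then show thesis using that by auto
qed

lemma skew:
  assumes "a \<in> G"
  shows "skew n G f a \<in> G" "f (replicate (n - 1) a @ [skew n G f a]) = a"
proof -
  have "set (replicate n a) \<subseteq> G" "length (replicate n a) = n" "n - 1 < n" "Suc (n - 1) = n"
    using assms arity by auto
  from solvable[OF assms this(2,1,3)] this(4)
  have "\<exists>!z. z \<in> G \<and> f (replicate (n - 1) a @ [z]) = a" by simp
  from theI'[OF this]
  show "skew n G f a \<in> G" "f (replicate (n - 1) a @ [skew n G f a]) = a"
    unfolding skew_def by auto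
qed

lemma replicate_pred:
  "replicate (n - 1) a = a # replicate (n - 2) a"
  "replicate (n - 1) a = replicate (n - 2) a @ [a]"
proof -
  have "n - 1 = Suc (n - 2)" using arity by simp
  then show "replicate (n - 1) a = a # replicate (n - 2) a"
    "replicate (n - 1) a = replicate (n - 2) a @ [a]"
    by (simp_all only: replicate_Suc replicate_append_same)
qed

text \<open>Let e be the skew element. In the word a^i a^(n-1) e a^j, bracketing a^(n-1) e leaves
  f(a, ..., a), while bracketing a^i e a^j leaves the value in question behind a^(n-1). Cancelling
  a^(n-1) identifies this value with a.\<close>

lemma skew_between:
  assumes a: "a \<in> G" and i: "i + j = n - 1"
  shows "f (replicate i a @ skew n G f a # replicate j a) = a"
proof -
  let ?e = "skew n G f a"
  note e = skew[OF a]
  have eq: "replicate i a @ (replicate (n - 1) a @ [?e]) @ replicate j a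
    = replicate (n - 1) a @ (replicate i a @ ?e # replicate j a) @ []"
    by (simp add: replicate_add[symmetric] add.commute
        flip: append_assoc)
  have "f (replicate i a @ f (replicate (n - 1) a @ [?e]) # replicate j a)
    = f (replicate (n - 1) a @ f (replicate i a @ ?e # replicate j a) # [])"
    by (rule assoc_append[OF eq]) (use i a e arity in auto)
  moreover have "replicate i a @ a # replicate j a = replicate (n - 1) a @ [a]"
    using i by (simp add: replicate_app_Cons_same replicate_append_same
        flip: replicate_Suc replicate_add)
  ultimately have "f (replicate (n - 1) a @ a # []) =
     f (replicate (n - 1) a @ f (replicate i a @ ?e # replicate j a) # [])"
    using e by simp
  then show ?thesis
    by (rule cancel[symmetric]) (use a i e arity in \<open>auto intro!: closed\<close>)
qed

text \<open>Since y = f(z, a, ..., a) for some z, the bracket can be moved to the last n letters,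
  which have the form a a^p e a^q and collapse to a by \<open>skew_between\<close>.\<close>

lemma skew_right_neutral:
  assumes a: "a \<in> G" and y: "y \<in> G" and p: "p + q = n - 2"
  shows "f (y # replicate p a @ skew n G f a # replicate q a) = y"
proof -
  let ?e = "skew n G f a"
  note e = skew[OF a]
  obtain z where z: "z \<in> G" "f ([] @ z # replicate (n - 1) a) = y"
    by (rule solution[OF y, of "[]" "replicate (n - 1) a"]) (use a in auto)
  note n1 = replicate_pred(2)[of a]
  have eq: "[] @ (z # replicate (n - 1) a) @ (replicate p a @ ?e # replicate q a)
    = (z # replicate (n - 2) a) @ (a # replicate p a @ ?e # replicate q a) @ []"
    by (simp add: n1 del: One_nat_def)
  have "f ([] @ f (z # replicate (n - 1) a) # (replicate p a @ ?e # replicate q a))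
    = f ((z # replicate (n - 2) a) @ f (a # replicate p a @ ?e # replicate q a) # [])"
    by (rule assoc_append[OF eq]) (use p a e z arity in auto)
  also have "f (a # replicate p a @ ?e # replicate q a) = a"
    using skew_between[OF a, of "Suc p" q] p arity by simp
  also have "(z # replicate (n - 2) a) @ a # [] = z # replicate (n - 1) a"
    by (simp add: n1 del: One_nat_def)
  finally show ?thesis using z by simp
qed

text \<open>The mirror argument: x = f(a, ..., a, z) for some z, and the bracket moves to the first
  n letters e a^(n-1), which collapse to a.\<close>

lemma skew_left_neutral:
  assumes a: "a \<in> G" and x: "x \<in> G"
  shows "f (skew n G f a # replicate (n - 2) a @ [x]) = x"
proof -
  let ?e = "skew n G f a"
  note e = skew[OF a]
  obtain z where z: "z \<in> G" "f (replicate (n - 1) a @ z # []) = x"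
    by (rule solution[OF x, of "replicate (n - 1) a" "[]"]) (use a in auto)
  note n1 = replicate_pred(1)[of a] and n2 = replicate_pred(2)[of a]
  have eq: "(?e # replicate (n - 2) a) @ (replicate (n - 1) a @ [z]) @ []
    = [] @ (?e # replicate (n - 1) a) @ (replicate (n - 2) a @ [z])"
    using n1 n2 by (metis append.assoc append_Cons append_Nil append_Nil2)
  have "f ((?e # replicate (n - 2) a) @ f (replicate (n - 1) a @ [z]) # [])
    = f ([] @ f (?e # replicate (n - 1) a) # (replicate (n - 2) a @ [z]))"
    by (rule assoc_append[OF eq]) (use a e z arity in auto)
  also have "f (?e # replicate (n - 1) a) = a"
    using skew_between[OF a, of 0 "n - 1"] by simp
  also have "[] @ a # (replicate (n - 2) a @ [z]) = replicate (n - 1) a @ [z]"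
    unfolding n1 by simp
  finally show ?thesis using z by simp
qed

section \<open>Multiplication in Post's cover\<close>

lemma f_star_closed:
  assumes "set zs \<subseteq> G" "length zs = n \<or> length zs = 2 * n - 1"
  shows "f_star n f zs \<in> G"
proof (cases "length zs = n")
  case False
  then have "length zs = 2 * n - 1" using assms by simp
  then have "f (take n zs) \<in> G" "length (f (take n zs) # drop n zs) = n"
    using assms arity by (auto intro!: closed dest: in_set_takeD)
  then show ?thesis using False assms
    by (auto simp: f_star_def intro!: closed dest!: in_set_dropD)
qed (use assms in \<open>auto simp: f_star_def intro: closed\<close>)

abbreviation Post_word :: "'a \<Rightarrow> 'a \<Rightarrow> nat \<Rightarrow> 'a \<Rightarrow> nat \<Rightarrow> 'a list" where
  "Post_word a x i y j \<equiv> [x] @ replicate i a @ [y] @ replicate j a @ [skew n G f a]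
    @ replicate (n - 2 - (i + j + 1) mod (n - 1)) a"

lemma Post_mult:
  "(x, i) \<otimes>\<^bsub>Post_cover n G f a\<^esub> (y, j) =
    (f_star n f (Post_word a x i y j), (i + j + 1) mod (n - 1))"
  by (simp add: Post_cover_def Let_def)

lemma Post_carrier: "carrier (Post_cover n G f a) = G \<times> {0..n - 2}"
  by (simp add: Post_cover_def)

lemma Post_mod_le: "k mod (n - 1) \<le> n - 2"
proof -
  have "k mod (n - 1) < n - 1" using arity by simp
  then show ?thesis by linarith
qed

text \<open>As i + j + 1 < 2(n - 1), the remainder subtracts n - 1 at most once. A wrap-around
  lengthens the padding by n - 1, which makes room for exactly one further application of
  \<open>f\<close>.\<close>

lemma Post_word_length:
  assumes "i \<le> n - 2" "j \<le> n - 2"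
  shows "length (Post_word a x i y j) = n \<or> length (Post_word a x i y j) = 2 * n - 1"
proof -
  have "length (Post_word a x i y j) = i + j + 3 + (n - 2 - (i + j + 1) mod (n - 1))" by simp
  moreover have "(i + j + 1) mod (n - 1) = (if i + j + 1 < n - 1 then i + j + 1
      else i + j + 1 - (n - 1))"
    using assms arity by (simp add: le_mod_geq)
  ultimately show ?thesis using assms arity by (auto split: if_splits)
qed

lemma Post_closed:
  assumes "a \<in> G" "x \<in> G" "y \<in> G" "i \<le> n - 2" "j \<le> n - 2"
  shows "(x, i) \<otimes>\<^bsub>Post_cover n G f a\<^esub> (y, j) \<in> G \<times> {0..n - 2}"
proof -
  have "f_star n f (Post_word a x i y j) \<in> G"
    by (rule f_star_closed) (use assms Post_word_length skew in auto)
  then show ?thesis using Post_mod_le by (simp add: Post_mult)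
qed

lemma Post_mult_zero_right:
  assumes "a \<in> G" "x \<in> G" "y \<in> G" "Suc i \<le> n - 2"
  shows "(x, i) \<otimes>\<^bsub>Post_cover n G f a\<^esub> (y, 0) =
    (f (x # replicate i a @ y # skew n G f a # replicate (n - 2 - Suc i) a), Suc i)"
proof -
  have "Suc i mod (n - 1) = Suc i" using assms by simp
  \<comment> \<open>From i + 1 \<le> n - 2 it follows that n \<ge> 3, so the truncated subtraction
    is exact; this equation settles the length test in \<open>f_star\<close>.\<close>
  moreover have "Suc (Suc (Suc (n - 3))) = n" using assms by simp
  ultimately show ?thesis using assms by (simp add: Post_mult f_star_def)
qed

text \<open>The index wraps to 0, so \<open>f\<close> is applied twice; the outer application only
  appends the skew element and n - 2 copies of \<open>a\<close>, which are absorbed by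
  \<open>skew_right_neutral\<close>.\<close>

lemma Post_mult_zero_right_wrap:
  assumes "a \<in> G" "x \<in> G" "y \<in> G"
  shows "(x, n - 2) \<otimes>\<^bsub>Post_cover n G f a\<^esub> (y, 0) = (f (x # replicate (n - 2) a @ [y]), 0)"
proof -
  obtain m where m: "n = Suc (Suc m)"
    using arity by (metis add_2_eq_Suc le_Suc_ex)
  have "f (f (x # replicate (n - 2) a @ [y]) # replicate 0 a @ skew n G f a # replicate (n - 2) a)
      = f (x # replicate (n - 2) a @ [y])"
    by (rule skew_right_neutral) (use assms arity in \<open>auto intro!: closed\<close>)
  then show ?thesis unfolding Post_mult by (simp add: f_star_def m)
qed

text \<open>The word to be evaluated is x a^(i+1) e a^(n-3-i), with e the skew element, so
  \<open>skew_right_neutral\<close> applies. Right multiplication by (a, 0) thus raises the index,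
  and every (x, i) is reached from (x, 0).\<close>

lemma Post_mult_generator:
  assumes "a \<in> G" "x \<in> G" "Suc i \<le> n - 2"
  shows "(x, i) \<otimes>\<^bsub>Post_cover n G f a\<^esub> (a, 0) = (x, Suc i)"
  using skew_right_neutral[OF assms(1,2), of "Suc i" "n - 2 - Suc i"] assms
  by (simp add: Post_mult_zero_right replicate_app_Cons_same)

text \<open>The second component of the product is j + 1 modulo n - 1 and determines j; the first
  component then determines y by cancellation in \<open>f\<close>.\<close>

lemma Post_mult_zero_left_inj:
  assumes a: "a \<in> G" and x: "x \<in> G"
  shows "inj_on (\<lambda>h. (x, 0) \<otimes>\<^bsub>Post_cover n G f a\<^esub> h) (G \<times> {0..n - 2})"
proof (rule inj_onI, clarify)
  fix y j y' j'
  assume y: "y \<in> G" "y' \<in> G" and j: "j \<in> {0..n - 2}" "j' \<in> {0..n - 2}"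
    and eq: "(x, 0) \<otimes>\<^bsub>Post_cover n G f a\<^esub> (y, j) = (x, 0) \<otimes>\<^bsub>Post_cover n G f a\<^esub> (y', j')"
  note e = skew[OF a]
  have "(j + 1) mod (n - 1) = (j' + 1) mod (n - 1)" using eq by (simp add: Post_mult)
  \<comment> \<open>Both j + 1 and j' + 1 lie between 1 and n - 1, so congruence modulo n - 1 means
    equality.\<close>
  then have jj: "j = j'" using j arity by (auto simp: mod_if split: if_splits)
  have F: "f_star n f (Post_word a x 0 y j) = f_star n f (Post_word a x 0 y' j)"
    using eq jj by (simp add: Post_mult)
  have "y = y'"
  proof (cases "j + 1 < n - 1")
    case True
    then have "Suc (Suc (Suc (n - 3))) = n" by simp
    with True have "f ([x] @ y # replicate j a @ skew n G f a # replicate (n - 2 - Suc j) a) =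
      f ([x] @ y' # replicate j a @ skew n G f a # replicate (n - 2 - Suc j) a)"
      using F \<open>Suc (Suc (Suc (n - 3))) = n\<close> by (simp add: f_star_def)
    then show ?thesis by (rule cancel) (use True y a x e in auto)
  next
    case False
    \<comment> \<open>For the last index \<open>f\<close> is applied twice; the outer application is
      removed by neutrality before y can be cancelled in the inner one.\<close>
    then have jn: "j = n - 2" using j arity by auto
    obtain m where m: "n = Suc (Suc m)"
      using arity by (metis add_2_eq_Suc le_Suc_ex)
    have N: "f (f (x # y # replicate (n - 2) a) # replicate 0 a @ skew n G f a
        # replicate (n - 2) a) = f (x # y # replicate (n - 2) a)" if "y \<in> G" for y
      by (rule skew_right_neutral) (use that a x arity in \<open>auto intro!: closed\<close>)
    have "f ([x] @ y # replicate (n - 2) a) = f ([x] @ y' # replicate (n - 2) a)"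
      using F N[OF y(1)] N[OF y(2)] by (simp add: f_star_def jn m)
    then show ?thesis by (rule cancel) (use y a x arity in auto)
  qed
  then show "y = y' \<and> j = j'" using jj by simp
qed

text \<open>These permutations serve later as substitutions in sums over the cover.\<close>

lemma Post_mult_zero_left_bij:
  assumes "a \<in> G" "x \<in> G" "finite G"
  shows "bij_betw (\<lambda>h. (x, 0) \<otimes>\<^bsub>Post_cover n G f a\<^esub> h) (G \<times> {0..n - 2}) (G \<times> {0..n - 2})"
  unfolding bij_betw_def
proof (intro conjI endo_inj_surj)
  show "(\<lambda>h. (x, 0) \<otimes>\<^bsub>Post_cover n G f a\<^esub> h) ` (G \<times> {0..n - 2}) \<subseteq> G \<times> {0..n - 2}"
    using Post_closed[OF assms(1,2), where i = 0] by (simp add: image_subset_iff)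
qed (use assms Post_mult_zero_left_inj in auto)

end

section \<open>Representations and the correspondence\<close>

lemma GL_iff:
  "A \<in> carrier (GL m) \<longleftrightarrow>
    A \<in> carrier_mat m m \<and> (\<exists>B\<in>carrier_mat m m. A * B = 1\<^sub>m m \<and> B * A = 1\<^sub>m m)"
  by (auto simp: units_of_def Units_def ring_mat_simps)

lemma GL_simps: "mult (GL m) = (*)" "one (GL m) = 1\<^sub>m m"
  by (simp_all add: units_of_def ring_mat_simps)

lemma group_GL: "group (GL m)"
proof -
  interpret ring "ring_mat TYPE(complex) m ()" by (rule ring_mat)
  show ?thesis by (rule units_group)
qed

lemma GL_carrier_mat: "A \<in> carrier (GL m) \<Longrightarrow> A \<in> carrier_mat m m"
  by (simp add: GL_iff)

lemma GL_inverse: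
  assumes "A \<in> carrier (GL m)"
  shows "inv\<^bsub>GL m\<^esub> A \<in> carrier (GL m)" "A * inv\<^bsub>GL m\<^esub> A = 1\<^sub>m m" "inv\<^bsub>GL m\<^esub> A * A = 1\<^sub>m m"
    "inv\<^bsub>GL m\<^esub> A \<in> carrier_mat m m"
proof -
  interpret group "GL m" by (rule group_GL)
  show "inv\<^bsub>GL m\<^esub> A \<in> carrier (GL m)" "A * inv\<^bsub>GL m\<^esub> A = 1\<^sub>m m" "inv\<^bsub>GL m\<^esub> A * A = 1\<^sub>m m"
    using assms r_inv[OF assms] l_inv[OF assms] inv_closed[OF assms] by (simp_all add: GL_simps)
  then show "inv\<^bsub>GL m\<^esub> A \<in> carrier_mat m m" by (simp add: GL_carrier_mat)
qed

lemma GL_mult_closed: "A \<in> carrier (GL m) \<Longrightarrow> B \<in> carrier (GL m) \<Longrightarrow> A * B \<in> carrier (GL m)"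
  using monoid.m_closed[OF group.is_monoid[OF group_GL]] by (simp add: GL_simps)

lemma GL_inv_mult:
  "A \<in> carrier (GL m) \<Longrightarrow> B \<in> carrier (GL m) \<Longrightarrow>
    inv\<^bsub>GL m\<^esub> (A * B) = inv\<^bsub>GL m\<^esub> B * inv\<^bsub>GL m\<^esub> A"
  using group.inv_mult_group[OF group_GL] by (simp add: GL_simps)

lemma GL_power_closed: "A \<in> carrier (GL m) \<Longrightarrow> A ^\<^sub>m i \<in> carrier (GL m)"
proof (induction i)
  case 0
  then show ?case
    using group.is_monoid[OF group_GL, of m, THEN monoid.one_closed] GL_carrier_mat[OF 0]
    by (simp add: GL_simps)
qed (simp add: GL_mult_closed)

lemma GL_cancel_left:
  assumes "A \<in> carrier (GL m)" "B \<in> carrier_mat m k" "C \<in> carrier_mat m k" "A * B = A * C"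
  shows "B = C"
proof -
  note i = GL_inverse[OF assms(1)] and A = GL_carrier_mat[OF assms(1)]
  have "inv\<^bsub>GL m\<^esub> A * (A * B) = inv\<^bsub>GL m\<^esub> A * (A * C)" using assms(4) by simp
  then show ?thesis
    using assms(2,3) i A
    by (simp flip: assoc_mult_mat[OF i(4) A assms(2)] assoc_mult_mat[OF i(4) A assms(3)])
qed

lemma foldr_mult_carrier:
  "set As \<subseteq> carrier_mat m m \<Longrightarrow> foldr (*) As (1\<^sub>m m) \<in> carrier_mat m m"
  by (induction As) auto

lemma foldr_mult_append:
  fixes As :: "complex mat list"
  assumes "set As \<subseteq> carrier_mat m m" "set Bs \<subseteq> carrier_mat m m"
  shows "foldr (*) (As @ Bs) (1\<^sub>m m) = foldr (*) As (1\<^sub>m m) * foldr (*) Bs (1\<^sub>m m)"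
  using assms
proof (induction As)
  case Nil
  then show ?case using foldr_mult_carrier[of Bs m] by simp
next
  case (Cons A As)
  then show ?case using foldr_mult_carrier[of Bs m] foldr_mult_carrier[of As m]
    by (simp add: assoc_mult_mat[of _ m m _ m _ m])
qed

text \<open>\<open>foldr\<close> splits off the first factor, whereas the matrix power splits off
  the last one; the list of equal entries is therefore extended at its end.\<close>

lemma foldr_mult_replicate:
  fixes A :: "complex mat"
  assumes "A \<in> carrier_mat m m"
  shows "foldr (*) (replicate k A) (1\<^sub>m m) = A ^\<^sub>m k"
proof (induction k)
  case (Suc k)
  have "foldr (*) (replicate (Suc k) A) (1\<^sub>m m) = foldr (*) (replicate k A @ [A]) (1\<^sub>m m)"
    by (simp only: replicate_Suc replicate_append_same)
  also have "\<dots> = A ^\<^sub>m k * A"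
    using assms Suc by (subst foldr_mult_append) auto
  finally show ?case by simp
qed (use assms in simp)

text \<open>The power unfolds on the right, so the factor split off acts on \<open>w\<close> first;
  hence the induction hypothesis must cover every vector of \<open>W\<close>.\<close>

lemma mult_mat_vec_power_mem:
  fixes A :: "complex mat"
  assumes "A \<in> carrier_mat m m" "W \<subseteq> carrier_vec m" "\<And>w. w \<in> W \<Longrightarrow> A *\<^sub>v w \<in> W" "w \<in> W"
  shows "A ^\<^sub>m i *\<^sub>v w \<in> W"
  using assms(4)
proof (induction i arbitrary: w)
  case 0
  then show ?case using assms by auto
next
  case (Suc i)
  have "A ^\<^sub>m Suc i *\<^sub>v w = A ^\<^sub>m i *\<^sub>v (A *\<^sub>v w)"
    using assms(1,2) Suc.prems by (auto intro!: assoc_mult_mat_vec pow_carrier_mat)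
  then show ?case using Suc assms(3) by simp
qed

section \<open>Extension of n-ary representations to Post's cover, and restriction back\<close>

lemma nary_rep_GL: "nary_rep n G f m \<Lambda> \<Longrightarrow> x \<in> G \<Longrightarrow> \<Lambda> x \<in> carrier (GL m)"
  by (auto simp: nary_rep_def)

lemma nary_rep_mat: "nary_rep n G f m \<Lambda> \<Longrightarrow> x \<in> G \<Longrightarrow> \<Lambda> x \<in> carrier_mat m m"
  by (rule GL_carrier_mat[OF nary_rep_GL])

text \<open>The restriction to the carrier is there because \<open>group_rep\<close> demands
  extensional functions.\<close>

definition Post_extension ::
    "nat \<Rightarrow> 'a set \<Rightarrow> 'a \<Rightarrow> ('a \<Rightarrow> complex mat) \<Rightarrow> 'a \<times> nat \<Rightarrow> complex mat" where
  "Post_extension n G a \<Lambda> = (\<lambda>(x, i)\<in>G \<times> {0..n - 2}. \<Lambda> x * (\<Lambda> a ^\<^sub>m i))"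

lemma Post_extension_apply:
  "x \<in> G \<Longrightarrow> i \<le> n - 2 \<Longrightarrow> Post_extension n G a \<Lambda> (x, i) = \<Lambda> x * (\<Lambda> a ^\<^sub>m i)"
  by (simp add: Post_extension_def)

context nary_group
begin

lemma nary_rep_f_star:
  assumes rep: "nary_rep n G f m \<Lambda>"
    and "set zs \<subseteq> G" "length zs = n \<or> length zs = 2 * n - 1"
  shows "\<Lambda> (f_star n f zs) = foldr (*) (map \<Lambda> zs) (1\<^sub>m m)"
proof (cases "length zs = n")
  case False
  let ?us = "take n zs" and ?vs = "drop n zs"
  have sets: "set ?us \<subseteq> G" "set ?vs \<subseteq> G" "length ?us = n"
    using assms(2,3) arity by (auto dest!: in_set_takeD in_set_dropD)
  have len: "length (f ?us # ?vs) = n" using False assms(3) arity by simp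
  have "set (f ?us # ?vs) \<subseteq> G" using sets closed by auto
  with len rep have "\<Lambda> (f (f ?us # ?vs)) = foldr (*) (map \<Lambda> (f ?us # ?vs)) (1\<^sub>m m)"
    unfolding nary_rep_def by blast
  also have "\<dots> = \<Lambda> (f ?us) * foldr (*) (map \<Lambda> ?vs) (1\<^sub>m m)" by simp
  also have "\<Lambda> (f ?us) = foldr (*) (map \<Lambda> ?us) (1\<^sub>m m)"
    using rep sets unfolding nary_rep_def by blast
  also have "foldr (*) (map \<Lambda> ?us) (1\<^sub>m m) * foldr (*) (map \<Lambda> ?vs) (1\<^sub>m m) =
      foldr (*) (map \<Lambda> ?us @ map \<Lambda> ?vs) (1\<^sub>m m)"
    by (rule foldr_mult_append[symmetric]) (use sets nary_rep_mat[OF rep] in auto)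
  also have "map \<Lambda> ?us @ map \<Lambda> ?vs = map \<Lambda> zs"
    by (simp flip: map_append)
  finally show ?thesis using False by (simp add: f_star_def)
qed (use assms in \<open>simp add: f_star_def nary_rep_def\<close>)

text \<open>Apply \<Lambda> to f(a, e, a, ..., a) = a, with e the skew element, and cancel the
  invertible matrix \<Lambda> a.\<close>

lemma nary_rep_skew:
  assumes rep: "nary_rep n G f m \<Lambda>" and a: "a \<in> G"
  shows "\<Lambda> (skew n G f a) * \<Lambda> a ^\<^sub>m (n - 2) = 1\<^sub>m m"
proof (rule GL_cancel_left)
  note M = nary_rep_mat[OF rep]
  note aM = M[OF a] and eM = M[OF skew(1)[OF a]]
  let ?w = "a # skew n G f a # replicate (n - 2) a"
  have "f (a # replicate 0 a @ skew n G f a # replicate (n - 2) a) = a"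
    using skew_right_neutral[OF a a, of 0 "n - 2"] by simp
  moreover have "\<Lambda> (f ?w) = foldr (*) (map \<Lambda> ?w) (1\<^sub>m m)"
  proof -
    have "length ?w = n" "set ?w \<subseteq> G" using arity a skew(1)[OF a] by auto
    then show ?thesis using rep unfolding nary_rep_def by blast
  qed
  ultimately show "\<Lambda> a * (\<Lambda> (skew n G f a) * \<Lambda> a ^\<^sub>m (n - 2)) = \<Lambda> a * 1\<^sub>m m"
    using aM eM by (simp add: foldr_mult_replicate del: foldr_replicate)
  show "\<Lambda> a \<in> carrier (GL m)" using nary_rep_GL[OF rep a] .
  show "\<Lambda> (skew n G f a) * \<Lambda> a ^\<^sub>m (n - 2) \<in> carrier_mat m m"
    using aM eM by (simp add: pow_carrier_mat)
qed simp

text \<open>On the product word \<Lambda> gives \<Lambda> x A^i \<Lambda> y A^j E A^(n-2-k), where A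
  and E are the images of \<open>a\<close> and of its skew element. The factor A^k for the new index
  k completes the tail to E A^(n-2), which is 1 by \<open>nary_rep_skew\<close>.\<close>

lemma Post_extension_mult:
  assumes rep: "nary_rep n G f m \<Lambda>" and a: "a \<in> G"
    and "x \<in> G" "i \<le> n - 2" "y \<in> G" "j \<le> n - 2"
  shows "Post_extension n G a \<Lambda> ((x, i) \<otimes>\<^bsub>Post_cover n G f a\<^esub> (y, j)) =
    Post_extension n G a \<Lambda> (x, i) * Post_extension n G a \<Lambda> (y, j)"
proof -
  define k where "k = (i + j + 1) mod (n - 1)"
  note M = nary_rep_mat[OF rep]
  note carr = M[OF a] M[OF skew(1)[OF a]] M[OF assms(3)] M[OF assms(5)]
    pow_carrier_mat[OF M[OF a]]
  let ?w = "Post_word a x i y j" and ?A = "\<Lambda> a" and ?E = "\<Lambda> (skew n G f a)"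
  have wG: "set ?w \<subseteq> G" using assms skew by auto
  note len = Post_word_length[OF assms(4,6), where a = a and x = x and y = y]
  have k: "k \<le> n - 2" unfolding k_def by (rule Post_mod_le)
  have Ak: "?A ^\<^sub>m (n - 2 - k) * ?A ^\<^sub>m k = ?A ^\<^sub>m (n - 2)"
  proof -
    have "?A ^\<^sub>m (n - 2 - k) * ?A ^\<^sub>m k =
        foldr (*) (replicate (n - 2 - k) ?A @ replicate k ?A) (1\<^sub>m m)"
      using carr by (subst foldr_mult_append) (auto simp: foldr_mult_replicate simp del: foldr_replicate)
    also have "\<dots> = ?A ^\<^sub>m (n - 2)"
      unfolding replicate_add[symmetric] le_add_diff_inverse2[OF k]
      by (rule foldr_mult_replicate[OF carr(1)])
    finally show ?thesis .
  qed
  have w: "\<Lambda> (f_star n f ?w) =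
    \<Lambda> x * (?A ^\<^sub>m i * (\<Lambda> y * (?A ^\<^sub>m j * (?E * ?A ^\<^sub>m (n - 2 - k)))))"
  proof -
    have "\<Lambda> (f_star n f ?w) = foldr (*) ([\<Lambda> x] @ replicate i ?A @ [\<Lambda> y] @ replicate j ?A @ [?E]
        @ replicate (n - 2 - k) ?A) (1\<^sub>m m)"
      using nary_rep_f_star[OF rep wG len] by (simp add: k_def)
    also have "\<dots> = foldr (*) [\<Lambda> x] (1\<^sub>m m) * (foldr (*) (replicate i ?A) (1\<^sub>m m) *
        (foldr (*) [\<Lambda> y] (1\<^sub>m m) * (foldr (*) (replicate j ?A) (1\<^sub>m m) *
        (foldr (*) [?E] (1\<^sub>m m) * foldr (*) (replicate (n - 2 - k) ?A) (1\<^sub>m m)))))"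
      using carr by (subst foldr_mult_append, force, force)+ simp
    finally show ?thesis using carr by (simp add: foldr_mult_replicate del: foldr_replicate)
  qed
  have "Post_extension n G a \<Lambda> ((x, i) \<otimes>\<^bsub>Post_cover n G f a\<^esub> (y, j)) =
      \<Lambda> (f_star n f ?w) * ?A ^\<^sub>m k"
    using f_star_closed[OF wG len] k by (simp add: Post_mult Post_extension_apply k_def)
  also have "\<dots> = \<Lambda> x * (?A ^\<^sub>m i * (\<Lambda> y * (?A ^\<^sub>m j * (?E * (?A ^\<^sub>m (n - 2 - k) * ?A ^\<^sub>m k)))))"
    unfolding w using carr
    by (simp add: assoc_mult_mat[of _ m m _ m _ m] mult_carrier_mat[of _ m m _ m])
  also have "\<dots> = \<Lambda> x * (?A ^\<^sub>m i * (\<Lambda> y * ?A ^\<^sub>m j))"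
    using carr unfolding Ak by (simp add: nary_rep_skew[OF rep a])
  also have "\<dots> = Post_extension n G a \<Lambda> (x, i) * Post_extension n G a \<Lambda> (y, j)"
    using carr assms by (simp add: Post_extension_apply assoc_mult_mat[of _ m m _ m _ m])
  finally show ?thesis .
qed

lemma Post_extension_GL:
  assumes rep: "nary_rep n G f m \<Lambda>" and "a \<in> G" "x \<in> G" "i \<le> n - 2"
  shows "Post_extension n G a \<Lambda> (x, i) \<in> carrier (GL m)"
  using assms nary_rep_GL[OF rep]
  by (simp add: Post_extension_apply GL_mult_closed GL_power_closed)

lemma group_rep_Post_extension:
  assumes rep: "nary_rep n G f m \<Lambda>" and a: "a \<in> G"
  shows "group_rep (Post_cover n G f a) m (Post_extension n G a \<Lambda>)"
  unfolding group_rep_def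
proof (intro conjI homI)
  show "1 \<le> m" using rep by (simp add: nary_rep_def)
  show "Post_extension n G a \<Lambda> \<in> extensional (carrier (Post_cover n G f a))"
    by (simp add: Post_extension_def Post_carrier)
next
  fix h assume "h \<in> carrier (Post_cover n G f a)"
  then show "Post_extension n G a \<Lambda> h \<in> carrier (GL m)"
    using Post_extension_GL[OF rep a] by (auto simp: Post_carrier)
next
  fix h h' assume "h \<in> carrier (Post_cover n G f a)" "h' \<in> carrier (Post_cover n G f a)"
  then show "Post_extension n G a \<Lambda> (h \<otimes>\<^bsub>Post_cover n G f a\<^esub> h') =
      Post_extension n G a \<Lambda> h \<otimes>\<^bsub>GL m\<^esub> Post_extension n G a \<Lambda> h'"
    unfolding Post_carrier GL_simps using Post_extension_mult[OF rep a]
    by (metis SigmaE atLeastAtMost_iff)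
qed

lemma Post_extension_zero:
  assumes "nary_rep n G f m \<Lambda>" "a \<in> G" "x \<in> G"
  shows "Post_extension n G a \<Lambda> (x, 0) = \<Lambda> x"
  using nary_rep_mat[OF assms(1,2)] nary_rep_mat[OF assms(1,3)] assms
  by (simp add: Post_extension_apply)

text \<open>Both representations have the same invariant subspaces: \<Lambda> x is the value at (x,
  0), and every other value is a product of some \<Lambda> x with copies of \<Lambda> a.\<close>

lemma irreducible_on_Post_extension:
  assumes rep: "nary_rep n G f m \<Lambda>" and a: "a \<in> G"
  shows "irreducible_on (carrier (Post_cover n G f a)) m (Post_extension n G a \<Lambda>) \<longleftrightarrow>
    irreducible_on G m \<Lambda>"
proof -
  have "(\<forall>h\<in>carrier (Post_cover n G f a). \<forall>w\<in>W. Post_extension n G a \<Lambda> h *\<^sub>v w \<in> W) \<longleftrightarrow>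
      (\<forall>x\<in>G. \<forall>w\<in>W. \<Lambda> x *\<^sub>v w \<in> W)" (is "?L \<longleftrightarrow> ?R")
    if W: "subspace class_ring W (module_vec TYPE(complex) m)" for W
  proof
    assume L: ?L
    have "\<Lambda> x *\<^sub>v w \<in> W" if "x \<in> G" "w \<in> W" for x w
      using L[rule_format, of "(x, 0)" w] that Post_extension_zero[OF rep a]
      by (simp add: Post_carrier)
    then show ?R by blast
  next
    assume R: ?R
    have sub: "W \<subseteq> carrier_vec m"
      using W unfolding subspace_def submodule_def by (simp add: module_vec_simps)
    have "Post_extension n G a \<Lambda> (x, i) *\<^sub>v w \<in> W" if "x \<in> G" "i \<le> n - 2" "w \<in> W" for x i w
    proof -
      note M = nary_rep_mat[OF rep a] nary_rep_mat[OF rep that(1)]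
      have "\<Lambda> a ^\<^sub>m i *\<^sub>v w \<in> W"
        using mult_mat_vec_power_mem[OF M(1) sub] R a that by blast
      moreover have "\<Lambda> x * \<Lambda> a ^\<^sub>m i *\<^sub>v w = \<Lambda> x *\<^sub>v (\<Lambda> a ^\<^sub>m i *\<^sub>v w)"
        using M sub that by (intro assoc_mult_mat_vec pow_carrier_mat) auto
      ultimately show ?thesis using R that by (simp add: Post_extension_apply)
    qed
    then show ?L by (auto simp: Post_carrier)
  qed
  then show ?thesis unfolding irreducible_on_def by blast
qed

text \<open>The skew element and copies of \<open>a\<close> pad the word to n arguments, while the
  index counts the factors. Multiplying by one more (y, 0) on the right creates the segment e
  a^(n-2) y, with e the skew element; rebracketing collapses it to y by
  \<open>skew_left_neutral\<close>.\<close>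

lemma group_rep_prefix:
  assumes rep: "group_rep (Post_cover n G f a) m \<Phi>" and a: "a \<in> G"
    and "xs \<noteq> []" "length xs \<le> n - 1" "set xs \<subseteq> G"
  shows "foldr (*) (map (\<lambda>x. \<Phi> (x, 0)) xs) (1\<^sub>m m) =
    \<Phi> (f (xs @ skew n G f a # replicate (n - 1 - length xs) a), length xs - 1)"
  using assms(3-)
proof (induction xs rule: rev_nonempty_induct)
  case (single x)
  have "\<Phi> (x, 0) \<in> carrier_mat m m"
    using rep single unfolding group_rep_def hom_def
    by (intro GL_carrier_mat) (auto simp: Post_carrier)
  then show ?case
    using skew_right_neutral[OF a, of x 0 "n - 2"] single by (simp add: numeral_2_eq_2)
next
  case (snoc y xs)
  let ?e = "skew n G f a" and ?t = "length xs"
  let ?u = "f (xs @ ?e # replicate (n - 1 - ?t) a)"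
  note e = skew[OF a]
  have y: "y \<in> G" and xs: "set xs \<subseteq> G" using snoc.prems by auto
  have t: "?t \<ge> 1" "Suc ?t \<le> n - 1" using snoc by (auto simp: Suc_leI)
  have hom: "\<Phi> ` (G \<times> {0..n - 2}) \<subseteq> carrier_mat m m"
    "\<And>g h. g \<in> G \<times> {0..n - 2} \<Longrightarrow> h \<in> G \<times> {0..n - 2} \<Longrightarrow>
      \<Phi> (g \<otimes>\<^bsub>Post_cover n G f a\<^esub> h) = \<Phi> g * \<Phi> h"
    using rep unfolding group_rep_def hom_def GL_simps
    by (auto simp: Post_carrier intro!: GL_carrier_mat)
  have u: "?u \<in> G" using t xs e a by (intro closed) auto
  have m: "\<Phi> (x, 0) \<in> carrier_mat m m" if "x \<in> G" for x using hom(1) that by auto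
  have "foldr (*) (map (\<lambda>x. \<Phi> (x, 0)) (xs @ [y])) (1\<^sub>m m)
      = foldr (*) (map (\<lambda>x. \<Phi> (x, 0)) xs) (1\<^sub>m m) * \<Phi> (y, 0)"
    using m xs right_mult_one_mat[OF m[OF y]] y
    unfolding map_append by (subst foldr_mult_append) auto
  also have "\<dots> = \<Phi> (?u, ?t - 1) * \<Phi> (y, 0)"
    using snoc.IH xs t by simp
  also have "\<dots> = \<Phi> ((?u, ?t - 1) \<otimes>\<^bsub>Post_cover n G f a\<^esub> (y, 0))"
    using u y t by (subst hom(2)) auto
  also have "(?u, ?t - 1) \<otimes>\<^bsub>Post_cover n G f a\<^esub> (y, 0) =
      (f (?u # replicate (?t - 1) a @ y # ?e # replicate (n - 2 - ?t) a), ?t)"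
  proof -
    have "Suc (?t - 1) = ?t" using t(1) by simp
    then show ?thesis
      using Post_mult_zero_right[OF a u y, of "?t - 1"] t(2) by simp
  qed
  also have "f (?u # replicate (?t - 1) a @ y # ?e # replicate (n - 2 - ?t) a)
      = f (xs @ f (?e # replicate (n - 2) a @ [y]) # ?e # replicate (n - 2 - ?t) a)"
  proof -
    \<comment> \<open>The padding behind the first skew element and the copies of \<open>a\<close>
      contributed by the index add up to n - 2.\<close>
    have r: "replicate (n - 1 - ?t) a @ replicate (?t - 1) a = replicate (n - 2) a"
      using t by (simp flip: replicate_add)
    have eq: "[] @ (xs @ ?e # replicate (n - 1 - ?t) a) @
        (replicate (?t - 1) a @ y # ?e # replicate (n - 2 - ?t) a) =
      xs @ (?e # replicate (n - 2) a @ [y]) @ (?e # replicate (n - 2 - ?t) a)"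
      by (simp flip: r)
    have "f ([] @ f (xs @ ?e # replicate (n - 1 - ?t) a) #
        (replicate (?t - 1) a @ y # ?e # replicate (n - 2 - ?t) a)) =
      f (xs @ f (?e # replicate (n - 2) a @ [y]) # (?e # replicate (n - 2 - ?t) a))"
      by (rule assoc_append[OF eq]) (use t xs a e y in auto)
    then show ?thesis by simp
  qed
  also have "f (?e # replicate (n - 2) a @ [y]) = y"
    by (rule skew_left_neutral[OF a y])
  finally show ?case using t by (simp add: numeral_2_eq_2)
qed

text \<open>Of n factors, \<open>group_rep_prefix\<close> handles the first n - 1 and ends at index
  n - 2; the last factor wraps the index to 0. The values at index 0 recover \<Phi> because (x, i)
  arises from (x, 0) by i right multiplications with (a, 0).\<close>

lemma group_rep_restrict:
  assumes rep: "group_rep (Post_cover n G f a) m \<Phi>" and a: "a \<in> G"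
  defines "\<Lambda> \<equiv> \<lambda>x\<in>G. \<Phi> (x, 0)"
  shows "nary_rep n G f m \<Lambda>" "Post_extension n G a \<Lambda> = \<Phi>"
proof -
  have hom: "\<Phi> ` (G \<times> {0..n - 2}) \<subseteq> carrier (GL m)"
    "\<And>g h. g \<in> G \<times> {0..n - 2} \<Longrightarrow> h \<in> G \<times> {0..n - 2} \<Longrightarrow>
      \<Phi> (g \<otimes>\<^bsub>Post_cover n G f a\<^esub> h) = \<Phi> g * \<Phi> h"
    using rep unfolding group_rep_def hom_def GL_simps by (auto simp: Post_carrier)
  have m: "\<Phi> (x, 0) \<in> carrier_mat m m" if "x \<in> G" for x
    using hom(1) that by (intro GL_carrier_mat) auto
  note e = skew[OF a]
  have "\<Lambda> (f xs) = foldr (*) (map \<Lambda> xs) (1\<^sub>m m)" if xs: "length xs = n" "set xs \<subseteq> G" for xs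
  proof -
    let ?us = "butlast xs" and ?y = "last xs" and ?e = "skew n G f a"
    have ne: "xs \<noteq> []" using xs arity by auto
    have xs_eq: "xs = ?us @ [?y]" using ne by simp
    have us: "set ?us \<subseteq> G" "length ?us = n - 1" "?us \<noteq> []"
      using xs arity by (auto dest: in_set_butlastD simp flip: length_0_conv)
    have y: "?y \<in> G" using xs ne by auto
    have u: "f (?us @ [?e]) \<in> G" using us e arity by (intro closed) auto
    have "map \<Lambda> xs = map (\<lambda>x. \<Phi> (x, 0)) xs" using xs by (auto simp: \<Lambda>_def)
    then have "foldr (*) (map \<Lambda> xs) (1\<^sub>m m) =
        foldr (*) (map (\<lambda>x. \<Phi> (x, 0)) (?us @ [?y])) (1\<^sub>m m)"
      unfolding xs_eq[symmetric] by (rule arg_cong)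
    also have "\<dots> = foldr (*) (map (\<lambda>x. \<Phi> (x, 0)) ?us) (1\<^sub>m m) * \<Phi> (?y, 0)"
      using m us(1) right_mult_one_mat[OF m[OF y]] y
      unfolding map_append by (subst foldr_mult_append) auto
    also have "\<dots> = \<Phi> (f (?us @ [?e]), n - 2) * \<Phi> (?y, 0)"
    proof -
      \<comment> \<open>A prefix of length n - 1 leaves room for the skew element only, so the
        padding by \<open>a\<close> is empty.\<close>
      have "length ?us - 1 = n - 2" "replicate (n - 1 - length ?us) a = []" using us(2) by simp_all
      then show ?thesis using group_rep_prefix[OF rep a us(3) _ us(1)] us(2) by (simp only:)
    qed
    also have "\<dots> = \<Phi> ((f (?us @ [?e]), n - 2) \<otimes>\<^bsub>Post_cover n G f a\<^esub> (?y, 0))"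
      using u y by (subst hom(2)) auto
    also have "\<dots> = \<Phi> (f (f (?us @ [?e]) # replicate (n - 2) a @ [?y]), 0)"
      using Post_mult_zero_right_wrap[OF a u y] by simp
    also have "f (f (?us @ [?e]) # replicate (n - 2) a @ [?y]) =
        f (?us @ f (?e # replicate (n - 2) a @ [?y]) # [])"
    proof -
      have "f ([] @ f (?us @ [?e]) # (replicate (n - 2) a @ [?y])) =
          f (?us @ f (?e # replicate (n - 2) a @ [?y]) # [])"
        by (rule assoc_append) (use us e a y arity in auto)
      then show ?thesis by simp
    qed
    also have "\<dots> = f xs" using skew_left_neutral[OF a y] ne by simp
    finally have "foldr (*) (map \<Lambda> xs) (1\<^sub>m m) = \<Phi> (f xs, 0)" .
    moreover have "\<Lambda> (f xs) = \<Phi> (f xs, 0)" using closed[OF xs] by (simp add: \<Lambda>_def)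
    ultimately show ?thesis by simp
  qed
  then show nrep: "nary_rep n G f m \<Lambda>"
    using rep hom(1) unfolding nary_rep_def group_rep_def by (auto simp: \<Lambda>_def)
  show "Post_extension n G a \<Lambda> = \<Phi>"
  proof (rule extensionalityI)
    show "Post_extension n G a \<Lambda> \<in> extensional (G \<times> {0..n - 2})"
      by (simp add: Post_extension_def)
    show "\<Phi> \<in> extensional (G \<times> {0..n - 2})"
      using rep by (simp add: group_rep_def Post_carrier)
    fix h assume "h \<in> G \<times> {0..n - 2}"
    then obtain x i where h: "h = (x, i)" "x \<in> G" "i \<le> n - 2" by auto
    have "\<Phi> (x, i) = \<Phi> (x, 0) * \<Phi> (a, 0) ^\<^sub>m i" using h(3)
    proof (induction i)
      case 0
      then show ?case using m[OF h(2)] m[OF a] by simp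
    next
      case (Suc i)
      have "\<Phi> (x, Suc i) = \<Phi> ((x, i) \<otimes>\<^bsub>Post_cover n G f a\<^esub> (a, 0))"
        using Post_mult_generator[OF a h(2) Suc.prems] by simp
      also have "\<dots> = \<Phi> (x, i) * \<Phi> (a, 0)" using Suc.prems h a by (subst hom(2)) auto
      also have "\<dots> = \<Phi> (x, 0) * \<Phi> (a, 0) ^\<^sub>m i * \<Phi> (a, 0)" using Suc by simp
      also have "\<dots> = \<Phi> (x, 0) * \<Phi> (a, 0) ^\<^sub>m Suc i"
        using m[OF h(2)] m[OF a] by (simp add: assoc_mult_mat[of _ m m _ m _ m] pow_carrier_mat)
      finally show ?case .
    qed
    then show "Post_extension n G a \<Lambda> h = \<Phi> h"
      using h a by (simp add: Post_extension_apply \<Lambda>_def)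
  qed
qed

text \<open>Injectivity: index 0 returns the original values, and extensionality fixes the function
  elsewhere. Surjectivity: \<open>group_rep_restrict\<close> supplies the preimage, which inherits
  irreducibility.\<close>

lemma bij_betw_Post_extension:
  assumes a: "a \<in> G"
  shows "bij_betw (Post_extension n G a) (irr_nary_reps n G f)
    (irr_group_reps (Post_cover n G f a))"
  unfolding bij_betw_def
proof
  show "inj_on (Post_extension n G a) (irr_nary_reps n G f)"
  proof (rule inj_onI)
    fix \<Lambda> \<Lambda>' assume *: "\<Lambda> \<in> irr_nary_reps n G f" "\<Lambda>' \<in> irr_nary_reps n G f"
      and eq: "Post_extension n G a \<Lambda> = Post_extension n G a \<Lambda>'"
    then obtain m m' where r: "nary_rep n G f m \<Lambda>" "nary_rep n G f m' \<Lambda>'"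
      by (auto simp: irr_nary_reps_def)
    have "\<Lambda> \<in> extensional G" "\<Lambda>' \<in> extensional G"
      using r by (auto simp: nary_rep_def PiE_def)
    then show "\<Lambda> = \<Lambda>'"
      by (rule extensionalityI)
        (metis eq Post_extension_zero[OF r(1) a] Post_extension_zero[OF r(2) a])
  qed
  show "Post_extension n G a ` irr_nary_reps n G f = irr_group_reps (Post_cover n G f a)"
  proof (intro equalityI subsetI)
    fix \<Phi> assume "\<Phi> \<in> Post_extension n G a ` irr_nary_reps n G f"
    then show "\<Phi> \<in> irr_group_reps (Post_cover n G f a)"
      unfolding irr_nary_reps_def irr_group_reps_def
      using group_rep_Post_extension[OF _ a] irreducible_on_Post_extension[OF _ a] by blast
  next
    fix \<Phi> assume "\<Phi> \<in> irr_group_reps (Post_cover n G f a)"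
    then obtain m where m: "group_rep (Post_cover n G f a) m \<Phi>"
      "irreducible_on (carrier (Post_cover n G f a)) m \<Phi>"
      by (auto simp: irr_group_reps_def)
    note r = group_rep_restrict[OF m(1) a]
    have "irreducible_on G m (\<lambda>x\<in>G. \<Phi> (x, 0))"
      using irreducible_on_Post_extension[OF r(1) a] m(2) r(2) by simp
    then show "\<Phi> \<in> Post_extension n G a ` irr_nary_reps n G f"
      using r unfolding irr_nary_reps_def by (metis (mono_tags, lifting) imageI mem_Collect_eq)
  qed
qed

end

section \<open>Finiteness\<close>

lemma subspace_vecI:
  assumes "W \<subseteq> carrier_vec m" "0\<^sub>v m \<in> W" "\<And>v w. v \<in> W \<Longrightarrow> w \<in> W \<Longrightarrow> v + w \<in> W"
    and "\<And>c v. v \<in> W \<Longrightarrow> c \<cdot>\<^sub>v v \<in> W"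
  shows "subspace class_ring W (module_vec TYPE(complex) m)"
  using assms vec_vs vec_module unfolding subspace_def submodule_def
  by (auto simp: module_vec_simps)

lemma mult_mat_unit_vec:
  fixes A :: "complex mat"
  assumes "A \<in> carrier_mat p q" "j < q"
  shows "A *\<^sub>v unit_vec q j = col A j"
  using assms by (intro eq_vecI) auto

lemma irreducible_onD:
  assumes "irreducible_on X m \<Phi>" "subspace class_ring W (module_vec TYPE(complex) m)"
    and "\<And>x w. x \<in> X \<Longrightarrow> w \<in> W \<Longrightarrow> \<Phi> x *\<^sub>v w \<in> W"
  shows "W = {0\<^sub>v m} \<or> W = carrier_vec m"
  using assms unfolding irreducible_on_def by blast

text \<open>The traces of TS and ST agree, and in characteristic 0 the traces of the two identity
  matrices determine their sizes.\<close>

lemma dims_eq_of_mutually_inverse: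
  fixes T :: "complex mat"
  assumes T: "T \<in> carrier_mat p q" and S: "S \<in> carrier_mat q p"
    and "T * S = 1\<^sub>m p" "S * T = 1\<^sub>m q"
  shows "p = q"
proof -
  have "of_nat p = (\<Sum>i<p. (T * S) $$ (i, i))" using assms(3) by simp
  also have "\<dots> = (\<Sum>i<p. \<Sum>k<q. T $$ (i, k) * S $$ (k, i))"
    using T S by (auto simp: scalar_prod_def atLeast0LessThan intro!: sum.cong)
  also have "\<dots> = (\<Sum>k<q. \<Sum>i<p. S $$ (k, i) * T $$ (i, k))"
    by (subst sum.swap) (simp add: mult.commute)
  also have "\<dots> = (\<Sum>k<q. (S * T) $$ (k, k))"
    using T S by (auto simp: scalar_prod_def atLeast0LessThan intro!: sum.cong)
  also have "\<dots> = of_nat q" using assms(4) by simp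
  finally show ?thesis by simp
qed

text \<open>The kernel of \<open>T\<close> is invariant under \<Psi> and its image under \<Phi>;
  since \<open>T\<close> is not zero, irreducibility makes the kernel trivial and the image
  everything. Preimages of the unit vectors then form the columns of an inverse.\<close>

lemma Schur:
  fixes T :: "complex mat"
  assumes irr: "irreducible_on X p \<Phi>" "irreducible_on X q \<Psi>"
    and \<Phi>: "\<And>x. x \<in> X \<Longrightarrow> \<Phi> x \<in> carrier_mat p p"
    and \<Psi>: "\<And>x. x \<in> X \<Longrightarrow> \<Psi> x \<in> carrier_mat q q"
    and T: "T \<in> carrier_mat p q" and nz: "T \<noteq> 0\<^sub>m p q"
    and comm: "\<And>x. x \<in> X \<Longrightarrow> \<Phi> x * T = T * \<Psi> x"
  shows "p = q" "T \<in> carrier (GL p)"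
proof -
  have swap: "\<Phi> x *\<^sub>v (T *\<^sub>v v) = T *\<^sub>v (\<Psi> x *\<^sub>v v)" if "x \<in> X" "v \<in> carrier_vec q" for x v
  proof -
    have "\<Phi> x *\<^sub>v (T *\<^sub>v v) = (\<Phi> x * T) *\<^sub>v v"
      by (rule assoc_mult_mat_vec[OF \<Phi>[OF that(1)] T that(2), symmetric])
    also have "\<dots> = T *\<^sub>v (\<Psi> x *\<^sub>v v)" unfolding comm[OF that(1)]
      by (rule assoc_mult_mat_vec[OF T \<Psi>[OF that(1)] that(2)])
    finally show ?thesis .
  qed
  let ?K = "{v \<in> carrier_vec q. T *\<^sub>v v = 0\<^sub>v p}"
  have "subspace class_ring ?K (module_vec TYPE(complex) q)"
    by (rule subspace_vecI)
      (use T in \<open>auto simp: mult_add_distrib_mat_vec[OF T] mult_mat_vec[OF T]\<close>)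
  moreover have "\<Psi> x *\<^sub>v v \<in> ?K" if "x \<in> X" "v \<in> ?K" for x v
  proof -
    have "\<Phi> x *\<^sub>v 0\<^sub>v p = 0\<^sub>v p" using \<Phi>[OF that(1)] by (intro eq_vecI) auto
    then show ?thesis using swap[OF that(1), of v] that \<Psi>[OF that(1)] by auto
  qed
  ultimately have "?K = {0\<^sub>v q} \<or> ?K = carrier_vec q"
    by (rule irreducible_onD[OF irr(2)])
  \<comment> \<open>Otherwise \<open>T\<close> kills every unit vector, so all its columns
    vanish.\<close>
  moreover have "?K \<noteq> carrier_vec q"
  proof
    assume K: "?K = carrier_vec q"
    have "T $$ (i, j) = 0" if "i < p" "j < q" for i j
    proof -
      have "unit_vec q j \<in> ?K" unfolding K by simp
      then have "col T j = 0\<^sub>v p" using mult_mat_unit_vec[OF T that(2)] by simp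
      then have "col T j $ i = 0" using that by simp
      then show ?thesis using that T by simp
    qed
    then have "T = 0\<^sub>m p q" using T by (intro eq_matI) auto
    then show False using nz by simp
  qed
  ultimately have ker: "?K = {0\<^sub>v q}" by blast
  have inj: "v = w" if "v \<in> carrier_vec q" "w \<in> carrier_vec q" "T *\<^sub>v v = T *\<^sub>v w" for v w
  proof -
    have "T *\<^sub>v (v - w) = 0\<^sub>v p"
      using that T by (simp add: mult_minus_distrib_mat_vec[OF T])
    then have "v - w \<in> ?K" using that by simp
    then have "v - w = 0\<^sub>v q" using ker by blast
    then have "(v - w) $ i = 0" if "i < q" for i using that by simp
    then show ?thesis using that by (intro eq_vecI) auto
  qed
  let ?I = "(\<lambda>v. T *\<^sub>v v) ` carrier_vec q"
  have "subspace class_ring ?I (module_vec TYPE(complex) p)"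
  proof (rule subspace_vecI)
    show "?I \<subseteq> carrier_vec p" using T by auto
    show "0\<^sub>v p \<in> ?I" using T by (intro image_eqI[of _ _ "0\<^sub>v q"]) auto
    show "v + w \<in> ?I" if vw: "v \<in> ?I" "w \<in> ?I" for v w
    proof -
      obtain v' w' where "v' \<in> carrier_vec q" "w' \<in> carrier_vec q" "v = T *\<^sub>v v'" "w = T *\<^sub>v w'"
        using vw by blast
      then show ?thesis
        by (intro image_eqI[of _ _ "v' + w'"]) (simp_all add: mult_add_distrib_mat_vec[OF T])
    qed
    show "c \<cdot>\<^sub>v v \<in> ?I" if v: "v \<in> ?I" for c v
    proof -
      obtain v' where "v' \<in> carrier_vec q" "v = T *\<^sub>v v'" using v by blast
      then show ?thesis
        by (intro image_eqI[of _ _ "c \<cdot>\<^sub>v v'"]) (simp_all add: mult_mat_vec[OF T])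
    qed
  qed
  moreover have "\<Phi> x *\<^sub>v w \<in> ?I" if x: "x \<in> X" and w: "w \<in> ?I" for x w
  proof -
    obtain v where "v \<in> carrier_vec q" "w = T *\<^sub>v v" using w by blast
    then show ?thesis using swap[OF x] \<Psi>[OF x] by (intro image_eqI[of _ _ "\<Psi> x *\<^sub>v v"]) auto
  qed
  ultimately have "?I = {0\<^sub>v p} \<or> ?I = carrier_vec p"
    by (rule irreducible_onD[OF irr(1)])
  \<comment> \<open>A zero image would put every vector into the kernel.\<close>
  moreover have "?I \<noteq> {0\<^sub>v p}" using \<open>?K \<noteq> carrier_vec q\<close> by blast
  ultimately have im: "?I = carrier_vec p" by blast
  \<comment> \<open>For i \<ge> p the vector \<open>unit_vec p i\<close> is zero, so no bound on
    \<open>i\<close> has to be carried into the choice of \<open>g\<close>.\<close>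
  have "\<exists>v. v \<in> carrier_vec q \<and> T *\<^sub>v v = unit_vec p i" for i
  proof -
    have "unit_vec p i \<in> ?I" unfolding im by simp
    then show ?thesis by (metis imageE)
  qed
  then obtain g where g: "\<And>i. g i \<in> carrier_vec q" "\<And>i. T *\<^sub>v g i = unit_vec p i" by metis
  define S where "S = mat_of_cols q (map g [0..<p])"
  have S: "S \<in> carrier_mat q p" by (simp add: S_def mat_of_cols_def)
  have TS: "T * S = 1\<^sub>m p"
  proof (rule mat_col_eqI)
    fix i assume "i < dim_col (1\<^sub>m p :: complex mat)"
    then have i: "i < p" by simp
    then have "col S i = g i" using g by (simp add: S_def)
    then show "col (T * S) i = col (1\<^sub>m p) i" using g i col_mult2[OF T S i] by simp
  qed (use T S in auto)
  \<comment> \<open>On a unit vector u, T(STu) = (TS)Tu = Tu, so injectivity of \<open>T\<close>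
    turns the right inverse into a two-sided one.\<close>
  have ST: "S * T = 1\<^sub>m q"
  proof (rule mat_col_eqI)
    fix j assume "j < dim_col (1\<^sub>m q :: complex mat)"
    then have j: "j < q" by simp
    have "T *\<^sub>v col (S * T) j = T *\<^sub>v (S *\<^sub>v col T j)" using col_mult2[OF S T j] by simp
    also have "\<dots> = (T * S) *\<^sub>v col T j" using T S j by (intro assoc_mult_mat_vec[symmetric]) auto
    also have "\<dots> = T *\<^sub>v unit_vec q j"
      using TS T j by (simp add: mult_mat_unit_vec[OF T j])
    finally show "col (S * T) j = col (1\<^sub>m q) j"
      using inj[of "col (S * T) j" "unit_vec q j"] S T j by (auto simp: col_dim)
  qed (use T S in auto)
  show "p = q" by (rule dims_eq_of_mutually_inverse[OF T S TS ST])
  then show "T \<in> carrier (GL p)" using T S TS ST unfolding GL_iff by blast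
qed

section \<open>Averaged matrix units and biorthogonal functions\<close>

lemma mult_mat_entry:
  assumes "A \<in> carrier_mat m k" "B \<in> carrier_mat k l" "i < m" "j < l"
  shows "(A * B) $$ (i, j) = (\<Sum>r<k. A $$ (i, r) * B $$ (r, j))"
  using assms by (auto simp: scalar_prod_def atLeast0LessThan intro!: sum.cong)

text \<open>The average \<open>\<Sum>\<^sub>h \<Phi>(h) E \<Psi>(h)\<inverse>\<close> of the matrix unit \<open>E\<close> with entry \<open>1\<close> at position \<open>(0, 0)\<close>.\<close>

definition averaged ::
    "'h set \<Rightarrow> nat \<Rightarrow> nat \<Rightarrow> ('h \<Rightarrow> complex mat) \<Rightarrow> ('h \<Rightarrow> complex mat) \<Rightarrow> complex mat" where
  "averaged H p q \<Phi> \<Psi> =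
    mat p q (\<lambda>(i, l). \<Sum>h\<in>H. \<Phi> h $$ (i, 0) * (inv\<^bsub>GL q\<^esub> \<Psi> h) $$ (0, l))"

lemma averaged_carrier: "averaged H p q \<Phi> \<Psi> \<in> carrier_mat p q"
  by (simp add: averaged_def)

text \<open>The relations A \<Phi>(h) = \<Phi>(\<tau> h) and \<Psi>(h)^(-1) = \<Psi>(\<tau> h)^(-1)
  B rewrite each summand in terms of \<tau> h; substituting along the permutation \<tau> then leaves
  B on the right. The calculation is done entry by entry.\<close>

lemma averaged_intertwines:
  assumes \<tau>: "bij_betw \<tau> H H" and pos: "p \<ge> 1" "q \<ge> 1"
    and \<Phi>: "\<And>h. h \<in> H \<Longrightarrow> \<Phi> h \<in> carrier (GL p)" "\<And>h. h \<in> H \<Longrightarrow> \<Phi> (\<tau> h) = A * \<Phi> h"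
    and \<Psi>: "\<And>h. h \<in> H \<Longrightarrow> \<Psi> h \<in> carrier (GL q)" "\<And>h. h \<in> H \<Longrightarrow> \<Psi> (\<tau> h) = B * \<Psi> h"
    and A: "A \<in> carrier (GL p)" and B: "B \<in> carrier (GL q)"
  shows "A * averaged H p q \<Phi> \<Psi> = averaged H p q \<Phi> \<Psi> * B"
proof (rule eq_matI)
  let ?T = "averaged H p q \<Phi> \<Psi>" and ?\<Psi>' = "\<lambda>h. inv\<^bsub>GL q\<^esub> \<Psi> h"
  note T = averaged_carrier[of H p q \<Phi> \<Psi>]
  note Am = GL_carrier_mat[OF A] and Bm = GL_carrier_mat[OF B]
  show "dim_row (A * ?T) = dim_row (?T * B)" "dim_col (A * ?T) = dim_col (?T * B)"
    using Am Bm T by auto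
  fix i l assume "i < dim_row (?T * B)" "l < dim_col (?T * B)"
  then have i: "i < p" and l: "l < q" using T Bm by auto
  have inv: "?\<Psi>' (\<tau> h) * B = ?\<Psi>' h" if "h \<in> H" for h
  proof -
    note Bi = GL_inverse[OF B] and \<Psi>i = GL_inverse[OF \<Psi>(1)[OF that]]
    have "?\<Psi>' (\<tau> h) * B = (?\<Psi>' h * inv\<^bsub>GL q\<^esub> B) * B"
      by (simp add: \<Psi>(2)[OF that] GL_inv_mult[OF B \<Psi>(1)[OF that]])
    also have "\<dots> = ?\<Psi>' h * (inv\<^bsub>GL q\<^esub> B * B)" by (rule assoc_mult_mat[OF \<Psi>i(4) Bi(4) Bm])
    finally show ?thesis using Bi \<Psi>i by simp
  qed
  have \<tau>H: "\<tau> h \<in> H" if "h \<in> H" for h using \<tau> that by (auto simp: bij_betw_def)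
  have "(A * ?T) $$ (i, l) = (\<Sum>k<p. A $$ (i, k) * (\<Sum>h\<in>H. \<Phi> h $$ (k, 0) * ?\<Psi>' h $$ (0, l)))"
    using l by (subst mult_mat_entry[OF Am T i l]) (simp add: averaged_def)
  also have "\<dots> = (\<Sum>h\<in>H. (\<Sum>k<p. A $$ (i, k) * \<Phi> h $$ (k, 0)) * ?\<Psi>' h $$ (0, l))"
    unfolding sum_distrib_left sum_distrib_right by (subst sum.swap) (simp add: mult.assoc)
  also have "\<dots> = (\<Sum>h\<in>H. \<Phi> (\<tau> h) $$ (i, 0) * ?\<Psi>' h $$ (0, l))"
  proof (rule sum.cong[OF refl])
    fix h assume h: "h \<in> H"
    show "(\<Sum>k<p. A $$ (i, k) * \<Phi> h $$ (k, 0)) * ?\<Psi>' h $$ (0, l) =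
        \<Phi> (\<tau> h) $$ (i, 0) * ?\<Psi>' h $$ (0, l)"
      using mult_mat_entry[OF Am GL_carrier_mat[OF \<Phi>(1)[OF h]] i, of 0] pos
      by (simp add: \<Phi>(2)[OF h])
  qed
  also have "\<dots> = (\<Sum>h\<in>H. \<Phi> (\<tau> h) $$ (i, 0) * (\<Sum>k<q. ?\<Psi>' (\<tau> h) $$ (0, k) * B $$ (k, l)))"
  proof (rule sum.cong[OF refl])
    fix h assume h: "h \<in> H"
    show "\<Phi> (\<tau> h) $$ (i, 0) * ?\<Psi>' h $$ (0, l) =
        \<Phi> (\<tau> h) $$ (i, 0) * (\<Sum>k<q. ?\<Psi>' (\<tau> h) $$ (0, k) * B $$ (k, l))"
      using mult_mat_entry[OF GL_inverse(4)[OF \<Psi>(1)[OF \<tau>H[OF h]]] Bm _ l, of 0] pos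
      by (simp add: inv[OF h])
  qed
  also have "\<dots> = (\<Sum>h\<in>H. \<Phi> h $$ (i, 0) * (\<Sum>k<q. ?\<Psi>' h $$ (0, k) * B $$ (k, l)))"
    by (rule sum.reindex_bij_betw[OF \<tau>])
  also have "\<dots> = (\<Sum>k<q. (\<Sum>h\<in>H. \<Phi> h $$ (i, 0) * ?\<Psi>' h $$ (0, k)) * B $$ (k, l))"
    unfolding sum_distrib_left sum_distrib_right by (subst sum.swap) (simp add: mult.assoc)
  also have "\<dots> = (?T * B) $$ (i, l)"
    using i by (subst mult_mat_entry[OF T Bm i l]) (simp add: averaged_def)
  finally show "(A * ?T) $$ (i, l) = (?T * B) $$ (i, l)" .
qed

text \<open>The average of \<open>E\<close> over a single representation has trace \<open>card H\<close>.\<close>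

lemma averaged_self_nonzero:
  assumes "finite H" "H \<noteq> {}" "p \<ge> 1" and \<Phi>: "\<And>h. h \<in> H \<Longrightarrow> \<Phi> h \<in> carrier (GL p)"
  shows "averaged H p p \<Phi> \<Phi> \<noteq> 0\<^sub>m p p"
proof
  assume z: "averaged H p p \<Phi> \<Phi> = 0\<^sub>m p p"
  have "0 = (\<Sum>i<p. averaged H p p \<Phi> \<Phi> $$ (i, i))" using z by simp
  also have "\<dots> = (\<Sum>i<p. \<Sum>h\<in>H. (inv\<^bsub>GL p\<^esub> \<Phi> h) $$ (0, i) * \<Phi> h $$ (i, 0))"
    by (simp add: averaged_def mult.commute)
  also have "\<dots> = (\<Sum>h\<in>H. \<Sum>i<p. (inv\<^bsub>GL p\<^esub> \<Phi> h) $$ (0, i) * \<Phi> h $$ (i, 0))"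
    by (rule sum.swap)
  \<comment> \<open>Each inner sum is the entry at (0, 0) of \<Phi>(h)^(-1) \<Phi>(h) = 1.\<close>
  also have "\<dots> = (\<Sum>h\<in>H. (1\<^sub>m p :: complex mat) $$ (0, 0))"
  proof (rule sum.cong[OF refl])
    fix h assume h: "h \<in> H"
    note i = GL_inverse[OF \<Phi>[OF h]]
    show "(\<Sum>i<p. (inv\<^bsub>GL p\<^esub> \<Phi> h) $$ (0, i) * \<Phi> h $$ (i, 0)) = (1\<^sub>m p :: complex mat) $$ (0, 0)"
      using mult_mat_entry[OF i(4) GL_carrier_mat[OF \<Phi>[OF h]], of 0 0] i assms by simp
  qed
  also have "\<dots> = of_nat (card H)" using assms by simp
  finally show False using assms by simp
qed

text \<open>If N exceeded card H, the two families could be padded by zeros to square matrices A and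
  B of size N. Their product is the matrix of pairings, diagonal with nonzero diagonal entries, yet
  A has a zero column.\<close>

lemma biorthogonal_card_le:
  fixes u v :: "nat \<Rightarrow> 'h \<Rightarrow> complex"
  assumes H: "finite H"
    and bi: "\<And>r s. r < N \<Longrightarrow> s < N \<Longrightarrow> (\<Sum>h\<in>H. u r h * v s h) = 0 \<longleftrightarrow> r \<noteq> s"
  shows "N \<le> card H"
proof (rule ccontr)
  assume "\<not> N \<le> card H"
  then have N: "card H < N" by simp
  obtain e where e: "bij_betw e {..<card H} H"
    using ex_bij_betw_nat_finite[OF H] by (auto simp: atLeast0LessThan)
  define A where "A = mat N N (\<lambda>(r, k). if k < card H then u r (e k) else 0)"
  define B where "B = mat N N (\<lambda>(k, s). if k < card H then v s (e k) else 0)"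
  have AB: "A \<in> carrier_mat N N" "B \<in> carrier_mat N N" by (auto simp: A_def B_def)
  have entry: "(A * B) $$ (r, s) = (\<Sum>h\<in>H. u r h * v s h)" if "r < N" "s < N" for r s
  proof -
    have "(A * B) $$ (r, s) =
        (\<Sum>k<N. if k < card H then u r (e k) * v s (e k) else 0)"
      using that by (subst mult_mat_entry[OF AB that]) (auto simp: A_def B_def intro!: sum.cong)
    also have "\<dots> = (\<Sum>k<card H. u r (e k) * v s (e k))"
      using N by (intro sum.mono_neutral_cong_right) auto
    also have "\<dots> = (\<Sum>h\<in>H. u r h * v s h)"
      by (rule sum.reindex_bij_betw[OF e])
    finally show ?thesis .
  qed
  have ABc: "A * B \<in> carrier_mat N N" using AB by simp
  have "upper_triangular (A * B)"
    using entry bi ABc AB by (intro upper_triangularI) auto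
  moreover have "0 \<notin> set (diag_mat (A * B))"
    using entry bi AB by (auto simp: diag_mat_def)
  ultimately have "det (A * B) \<noteq> 0"
    using upper_triangular_imp_det_eq_0_iff[OF ABc] by blast
  \<comment> \<open>Expansion along the column with index card H, the first padded one.\<close>
  moreover have "det A = 0"
    by (subst laplace_expansion_column[OF AB(1) N]) (use N in \<open>simp add: A_def\<close>)
  ultimately show False using det_mult[OF AB] by simp
qed

section \<open>Equivalence of n-ary representations and the bound on the number of classes\<close>

context nary_group
begin

text \<open>Matrices carry their dimensions and \<open>G\<close> is not empty. This identifies the
  two degrees that occur in the proof of transitivity.\<close>

lemma nary_rep_degree_unique:
  assumes "nary_rep n G f m \<Lambda>" "nary_rep n G f m' \<Lambda>"
  shows "m = m'"
proof -
  obtain x where "x \<in> G" using nonempty by blast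
  then have "\<Lambda> x \<in> carrier_mat m m" "\<Lambda> x \<in> carrier_mat m' m'"
    using assms by (auto intro: nary_rep_mat)
  then show ?thesis by auto
qed

text \<open>Reduces equivalence to an intertwining relation free of inverses, the form in which the
  averaged matrices arise.\<close>

lemma nary_rep_equivI:
  assumes "nary_rep n G f m \<Lambda>" "nary_rep n G f m \<Lambda>'" "T \<in> carrier (GL m)"
    and "\<And>x. x \<in> G \<Longrightarrow> \<Lambda>' x * T = T * \<Lambda> x"
  shows "(\<Lambda>, \<Lambda>') \<in> nary_rep_equiv n G f"
proof -
  note Ti = GL_inverse[OF assms(3)]
  have "\<Lambda>' x = T * \<Lambda> x * inv\<^bsub>GL m\<^esub> T" if x: "x \<in> G" for x
  proof -
    note M = nary_rep_mat[OF assms(2) x] GL_carrier_mat[OF assms(3)]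
    have "T * \<Lambda> x * inv\<^bsub>GL m\<^esub> T = \<Lambda>' x * (T * inv\<^bsub>GL m\<^esub> T)"
      unfolding assms(4)[OF x, symmetric] by (rule assoc_mult_mat[OF M Ti(4)])
    then show ?thesis using Ti M by simp
  qed
  then show ?thesis using assms(1-3) unfolding nary_rep_equiv_def by blast
qed

lemma nary_rep_equivE:
  assumes "(\<Lambda>, \<Lambda>') \<in> nary_rep_equiv n G f"
  obtains m T where "nary_rep n G f m \<Lambda>" "nary_rep n G f m \<Lambda>'" "T \<in> carrier (GL m)"
    "\<And>x. x \<in> G \<Longrightarrow> \<Lambda>' x * T = T * \<Lambda> x"
proof -
  obtain m T where r: "nary_rep n G f m \<Lambda>" "nary_rep n G f m \<Lambda>'" "T \<in> carrier (GL m)"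
    and eq: "\<And>x. x \<in> G \<Longrightarrow> \<Lambda>' x = T * \<Lambda> x * inv\<^bsub>GL m\<^esub> T"
    using assms unfolding nary_rep_equiv_def by blast
  note Ti = GL_inverse[OF r(3)] and T = GL_carrier_mat[OF r(3)]
  have "\<Lambda>' x * T = T * \<Lambda> x" if x: "x \<in> G" for x
  proof -
    have TL: "T * \<Lambda> x \<in> carrier_mat m m" using T nary_rep_mat[OF r(1) x] by simp
    have "\<Lambda>' x * T = T * \<Lambda> x * (inv\<^bsub>GL m\<^esub> T * T)"
      unfolding eq[OF x] by (rule assoc_mult_mat[OF TL Ti(4) T])
    then show ?thesis using Ti(3) right_mult_one_mat[OF TL] by simp
  qed
  then show thesis using that r by blast
qed

lemma sym_nary_rep_equiv: "sym (nary_rep_equiv n G f)"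
proof (rule symI)
  fix \<Lambda> \<Lambda>' assume "(\<Lambda>, \<Lambda>') \<in> nary_rep_equiv n G f"
  then obtain m T where r: "nary_rep n G f m \<Lambda>" "nary_rep n G f m \<Lambda>'" "T \<in> carrier (GL m)"
    and eq: "\<And>x. x \<in> G \<Longrightarrow> \<Lambda>' x * T = T * \<Lambda> x"
    by (rule nary_rep_equivE) blast
  let ?S = "inv\<^bsub>GL m\<^esub> T"
  note Ti = GL_inverse[OF r(3)] and T = GL_carrier_mat[OF r(3)]
  show "(\<Lambda>', \<Lambda>) \<in> nary_rep_equiv n G f"
  proof (rule nary_rep_equivI[OF r(2,1) Ti(1)])
    fix x assume x: "x \<in> G"
    note M = nary_rep_mat[OF r(1) x] and M' = nary_rep_mat[OF r(2) x]
    \<comment> \<open>The inverse matrix intertwines in the opposite direction: the two sides agree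
      after left multiplication by \<open>T\<close>, which is then cancelled.\<close>
    have "T * (\<Lambda> x * ?S) = \<Lambda>' x * T * ?S"
      using assoc_mult_mat[OF T M Ti(4)] eq[OF x] by simp
    also have "\<dots> = \<Lambda>' x" using assoc_mult_mat[OF M' T Ti(4)] Ti M' by simp
    also have "\<dots> = T * (?S * \<Lambda>' x)" using assoc_mult_mat[OF T Ti(4) M'] Ti M' by simp
    finally show "\<Lambda> x * ?S = ?S * \<Lambda>' x"
      by (rule GL_cancel_left[OF r(3), rotated 2]) (use M M' Ti in auto)
  qed
qed

lemma trans_nary_rep_equiv: "trans (nary_rep_equiv n G f)"
proof (rule transI)
  fix \<Lambda>1 \<Lambda>2 \<Lambda>3
  assume a: "(\<Lambda>1, \<Lambda>2) \<in> nary_rep_equiv n G f" and b: "(\<Lambda>2, \<Lambda>3) \<in> nary_rep_equiv n G f"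
  from a obtain m S where r: "nary_rep n G f m \<Lambda>1" "nary_rep n G f m \<Lambda>2" "S \<in> carrier (GL m)"
    and eq: "\<And>x. x \<in> G \<Longrightarrow> \<Lambda>2 x * S = S * \<Lambda>1 x"
    by (rule nary_rep_equivE) blast
  from b obtain m' T where r': "nary_rep n G f m' \<Lambda>2" "nary_rep n G f m' \<Lambda>3"
    "T \<in> carrier (GL m')" and eq': "\<And>x. x \<in> G \<Longrightarrow> \<Lambda>3 x * T = T * \<Lambda>2 x"
    by (rule nary_rep_equivE) blast
  have m: "m' = m" using nary_rep_degree_unique[OF r'(1) r(2)] .
  note r' = r'[unfolded m]
  note T = GL_carrier_mat[OF r'(3)] and S = GL_carrier_mat[OF r(3)]
  show "(\<Lambda>1, \<Lambda>3) \<in> nary_rep_equiv n G f"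
  proof (rule nary_rep_equivI[OF r(1) r'(2) GL_mult_closed[OF r'(3) r(3)]])
    fix x assume x: "x \<in> G"
    note M = nary_rep_mat[OF r(1) x] nary_rep_mat[OF r(2) x] nary_rep_mat[OF r'(2) x]
    have "\<Lambda>3 x * (T * S) = \<Lambda>3 x * T * S" by (rule assoc_mult_mat[OF M(3) T S, symmetric])
    also have "\<dots> = T * (\<Lambda>2 x * S)" unfolding eq'[OF x] by (rule assoc_mult_mat[OF T M(2) S])
    also have "\<dots> = T * S * \<Lambda>1 x" unfolding eq[OF x] by (rule assoc_mult_mat[OF T S M(1), symmetric])
    finally show "\<Lambda>3 x * (T * S) = T * S * \<Lambda>1 x" .
  qed
qed

text \<open>In \<open>averaged_intertwines\<close> the permutation \<tau> is left multiplication by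
  (x, 0), and A and B are \<Lambda> x and \<Lambda>' x; multiplicativity of the extensions gives the
  required equations.\<close>

lemma averaged_Post_extension_intertwines:
  assumes rep: "nary_rep n G f p \<Lambda>" "nary_rep n G f q \<Lambda>'" and "finite G" "a \<in> G" "x \<in> G"
  defines "T \<equiv> averaged (G \<times> {0..n - 2}) p q (Post_extension n G a \<Lambda>) (Post_extension n G a \<Lambda>')"
  shows "\<Lambda> x * T = T * \<Lambda>' x"
  unfolding T_def
proof (rule averaged_intertwines[OF Post_mult_zero_left_bij])
  show "1 \<le> p" "1 \<le> q" using rep by (auto simp: nary_rep_def)
  fix h assume "h \<in> G \<times> {0..n - 2}"
  then obtain y j where h: "h = (y, j)" "y \<in> G" "j \<le> n - 2" by auto
  show "Post_extension n G a \<Lambda> h \<in> carrier (GL p)" "Post_extension n G a \<Lambda>' h \<in> carrier (GL q)"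
    unfolding h(1) using Post_extension_GL rep assms h by blast+
  show "Post_extension n G a \<Lambda> ((x, 0) \<otimes>\<^bsub>Post_cover n G f a\<^esub> h) = \<Lambda> x * Post_extension n G a \<Lambda> h"
    "Post_extension n G a \<Lambda>' ((x, 0) \<otimes>\<^bsub>Post_cover n G f a\<^esub> h) = \<Lambda>' x * Post_extension n G a \<Lambda>' h"
    unfolding h(1) using assms h
    by (simp_all add: Post_extension_mult[OF rep(1)] Post_extension_mult[OF rep(2)]
        Post_extension_zero[OF rep(1)] Post_extension_zero[OF rep(2)])
qed (use assms nary_rep_GL in auto)

text \<open>The (0, 0) coefficient of the r-th extension, paired over the cover with a coefficient
  in row 0 of the inverse of the s-th, is an entry of the averaged matrix \<open>T r s\<close>. By
  Schur's lemma this matrix is zero for r \<noteq> s and invertible for r = s, so a suitable column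
  for each s makes the two families biorthogonal.\<close>

lemma inequivalent_irr_card_le:
  assumes fin: "finite G"
    and irr: "\<And>r. r < N \<Longrightarrow> \<Lambda> r \<in> irr_nary_reps n G f"
    and ineq: "\<And>r s. r < N \<Longrightarrow> s < N \<Longrightarrow> r \<noteq> s \<Longrightarrow> (\<Lambda> r, \<Lambda> s) \<notin> nary_rep_equiv n G f"
  shows "N \<le> card (G \<times> {0..n - 2})"
proof -
  obtain a where a: "a \<in> G" using nonempty by blast
  let ?H = "G \<times> {0..n - 2}"
  have H: "finite ?H" "?H \<noteq> {}" using fin nonempty by auto
  have "\<exists>m. nary_rep n G f m (\<Lambda> r) \<and> irreducible_on G m (\<Lambda> r)" if "r < N" for r
    using irr[OF that] by (simp add: irr_nary_reps_def)
  then obtain m where m: "\<And>r. r < N \<Longrightarrow> nary_rep n G f (m r) (\<Lambda> r)"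
    "\<And>r. r < N \<Longrightarrow> irreducible_on G (m r) (\<Lambda> r)" by metis
  have pos: "m r \<ge> 1" if "r < N" for r using m(1)[OF that] by (simp add: nary_rep_def)
  define \<Phi> where "\<Phi> r = Post_extension n G a (\<Lambda> r)" for r
  define T where "T r s = averaged ?H (m r) (m s) (\<Phi> r) (\<Phi> s)" for r s
  have T: "T r s \<in> carrier_mat (m r) (m s)" for r s by (simp add: T_def averaged_carrier)
  have comm: "\<Lambda> r x * T r s = T r s * \<Lambda> s x" if "r < N" "s < N" "x \<in> G" for r s x
    unfolding T_def \<Phi>_def
    by (rule averaged_Post_extension_intertwines[OF m(1)[OF that(1)] m(1)[OF that(2)] fin a that(3)])
  note Schur_rs = Schur[OF m(2) m(2) nary_rep_mat[OF m(1)] nary_rep_mat[OF m(1)] T _ comm]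
  have zero: "T r s = 0\<^sub>m (m r) (m s)" if rs: "r < N" "s < N" "r \<noteq> s" for r s
  proof (rule ccontr)
    assume nz: "T r s \<noteq> 0\<^sub>m (m r) (m s)"
    have "m r = m s" "T r s \<in> carrier (GL (m r))"
      using Schur_rs[of r s] rs nz by blast+
    \<comment> \<open>\<open>T r s\<close> carries \<Lambda> s to \<Lambda> r, so
      \<open>ineq\<close> is applied with the two indices exchanged.\<close>
    then have "(\<Lambda> s, \<Lambda> r) \<in> nary_rep_equiv n G f"
      using m(1)[OF rs(1)] m(1)[OF rs(2)] comm[OF rs(1,2)]
      by (intro nary_rep_equivI[of "m r"]) auto
    then show False using ineq rs by blast
  qed
  \<comment> \<open>Row 0 of an invertible matrix is not zero; the position of a nonzero entry
    becomes the column \<open>l s\<close>.\<close>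
  have "\<exists>l<m s. T s s $$ (0, l) \<noteq> 0" if s: "s < N" for s
  proof (rule ccontr)
    assume z: "\<not> (\<exists>l<m s. T s s $$ (0, l) \<noteq> 0)"
    have "T s s \<noteq> 0\<^sub>m (m s) (m s)"
      unfolding T_def
      by (rule averaged_self_nonzero[OF H pos[OF s]])
        (use Post_extension_GL[OF m(1)[OF s] a] in \<open>auto simp: \<Phi>_def\<close>)
    then have G: "T s s \<in> carrier (GL (m s))" using Schur_rs[of s s] s by blast
    have "1 = (T s s * inv\<^bsub>GL (m s)\<^esub> T s s) $$ (0, 0)"
      unfolding GL_inverse(2)[OF G] using pos[OF s] by simp
    also have "\<dots> = 0"
      using z pos[OF s] by (subst mult_mat_entry[OF T GL_inverse(4)[OF G]]) auto
    finally show False by simp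
  qed
  then obtain l where l: "\<And>s. s < N \<Longrightarrow> l s < m s" "\<And>s. s < N \<Longrightarrow> T s s $$ (0, l s) \<noteq> 0"
    by metis
  show ?thesis
  proof (rule biorthogonal_card_le[OF H(1)])
    fix r s assume rs: "r < N" "s < N"
    have "(\<Sum>h\<in>?H. \<Phi> r h $$ (0, 0) * (inv\<^bsub>GL (m s)\<^esub> \<Phi> s h) $$ (0, l s)) = T r s $$ (0, l s)"
      using pos[OF rs(1)] l(1)[OF rs(2)] by (simp add: T_def averaged_def)
    moreover have "T r s $$ (0, l s) = 0 \<longleftrightarrow> r \<noteq> s"
      using zero[OF rs] l[OF rs(2)] pos[OF rs(1)] by (cases "r = s") auto
    ultimately show "(\<Sum>h\<in>?H. \<Phi> r h $$ (0, 0) * (inv\<^bsub>GL (m s)\<^esub> \<Phi> s h) $$ (0, l s)) = 0 \<longleftrightarrow> r \<noteq> s"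
      by simp
  qed
qed

text \<open>Distinct classes have inequivalent representatives, so
  \<open>inequivalent_irr_card_le\<close> bounds the size of every finite set of classes by one
  constant, and a set with this property is finite.\<close>

lemma finite_irr_nary_reps_quotient:
  assumes "finite G"
  shows "finite (irr_nary_reps n G f // nary_rep_equiv n G f)" (is "finite (?I // ?R)")
proof -
  have "card C \<le> card (G \<times> {0..n - 2})" if C: "C \<subseteq> ?I // ?R" "finite C" for C
  proof -
    obtain c where c: "bij_betw c {..<card C} C"
      using ex_bij_betw_nat_finite[OF C(2)] by (auto simp: atLeast0LessThan)
    have "\<exists>\<Lambda>. \<Lambda> \<in> ?I \<and> c r = ?R `` {\<Lambda>}" if "r < card C" for r
    proof -
      have "c r \<in> ?I // ?R" using c C(1) that by (auto simp: bij_betw_def)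
      then show ?thesis by (auto elim: quotientE)
    qed
    then obtain \<Lambda> where \<Lambda>: "\<And>r. r < card C \<Longrightarrow> \<Lambda> r \<in> ?I" "\<And>r. r < card C \<Longrightarrow> c r = ?R `` {\<Lambda> r}"
      by metis
    show ?thesis
    proof (rule inequivalent_irr_card_le[OF assms \<Lambda>(1)])
      fix r s assume rs: "r < card C" "s < card C" "r \<noteq> s"
      then have "c r \<noteq> c s" using c by (auto simp: bij_betw_def inj_on_def)
      then have ne: "?R `` {\<Lambda> r} \<noteq> ?R `` {\<Lambda> s}" using \<Lambda>(2) rs by simp
      show "(\<Lambda> r, \<Lambda> s) \<notin> ?R"
      proof
        assume "(\<Lambda> r, \<Lambda> s) \<in> ?R"
        then have "?R `` {\<Lambda> r} = ?R `` {\<Lambda> s}"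
          using sym_nary_rep_equiv trans_nary_rep_equiv by (blast dest: symD transD)
        then show False using ne by simp
      qed
    qed
  qed
  then show ?thesis using finite_if_finite_subsets_card_bdd by blast
qed

end

theorem theorem2p5:
  fixes n :: nat and G :: "'a set" and f :: "'a list \<Rightarrow> 'a"
  assumes "nary_group n G f"
  shows "(\<forall>a\<in>G. bij_betw (\<lambda>\<Lambda>. \<lambda>(x, i)\<in>G \<times> {0..n - 2}. \<Lambda> x * (\<Lambda> a ^\<^sub>m i))
            (irr_nary_reps n G f) (irr_group_reps (Post_cover n G f a))) \<and>
         (finite G \<longrightarrow> finite (irr_nary_reps n G f // nary_rep_equiv n G f))"
proof -
  interpret nary_group n G f by fact
  show ?thesis
    using bij_betw_Post_extension finite_irr_nary_reps_quotient
    unfolding Post_extension_def by blast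
qed

end
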